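(* Let $1\le p\le 2$ and let $B=L^p([0,1],\mathbb R^d)$ with norm $\|x\|_B=\bigl(\int_0^1|x_t|^p\,dt\bigr)^{1/p}$. Let $G:B\to B$ be a function such that the equation $G(x)=0$ has a unique solution $x^*\in B$, and suppose there are constants $0<\rho<1$ and $1\le\theta<\infty$ with $$\|\theta^{-1}G(x)-(x-x^* )\|_B\le\rho\|x-x^*\|_B\quad\text{for all }x\in B.$$ For $n\ge 0$ let $\lambda_n:B^{n+1}\to\mathbb R$ be functions such that for some constant $C<\infty$, $$|\lambda_n(u_0,\dots,u_n)|\le C\bigl(1+\max_{0\le k\le n}\|u_k\|_B\bigr)\quad\text{for all }n\ge 0,\ u_0,\dots,u_n\in B.$$ Let $\{\alpha_n:n\ge 0\}$ be a sequence of constants in $(0,1)$ with $\lim_n\alpha_n=0$ and $\sum_{n=0}^\infty\alpha_n=\infty$. Let $\{Z_n:n\ge 0\}$ be a sequence of $B$-valued random variables $Z_n=(Z_{n,t})_{0\le t\le 1}$ on a probability space $(\Omega,\mathcal F,\mathbb P)$, and write $$\overline Z_{n+1,t}=\mathbb E\bigl[Z_{n+1,t}\mathbf 1_{\{\alpha_n|Z_{n+1,t}|<1\}}\mid\sigma(Z_j:j\le n)\bigr].$$ Suppose there are sequences of constants $\{\delta_n\}$, $\{\mu_n\}$, $\{\sigma_n^2\}$, $n\ge 0$, such that for all $n\ge 0$ $$\mathbb E\Bigl[\Bigl(\int_0^1|Z_{n+1,t}|^p\mathbf 1_{\{|\alpha_nZ_{n+1,t}|\ge 1\}}\,dt\Bigr)^{1/p}\Bigr]\le\delta_n,$$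 $$\mathbb E\Bigl[\Bigl(\int_0^1|\overline Z_{n+1,t}|^p\,dt\Bigr)^{1/p}\Bigr]\le\mu_n,$$ $$\mathbb E\Bigl[\int_0^1\bigl|Z_{n+1,t}\mathbf 1_{\{|\alpha_nZ_{n+1,t}|<1\}}-\overline Z_{n+1,t}\bigr|^2dt\Bigr]\le\sigma_n^2,$$ and $$\sum_{n=0}^\infty\alpha_n\delta_n<\infty,\qquad\sum_{n=0}^\infty\alpha_n\mu_n<\infty,\qquad\sum_{n=0}^\infty\alpha_n^2\sigma_n^2<\infty.$$ Fix $y_0\in B$ and define $Y_0=y_0$ and $$Y_{n+1}=Y_n-\alpha_n\bigl(G(Y_n)+\lambda_n(Y_0,\dots,Y_n)Z_{n+1}\bigr),\quad n\ge 0.$$ Then $\{Y_{n+1}:n\ge 0\}$ converges to $x^*$ almost surely.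
   Context: $[0,1]$ carries Lebesgue measure, $|\cdot|$ is the Euclidean norm on $\mathbb R^d$, $\sigma(Z_j:j\le n)$ is the $\sigma$-field generated by $Z_0,\dots,Z_n$, and $\mathbf 1_A$ is the indicator of $A$. For a $B$-valued random variable $Z$, $(\omega,t)\mapsto Z_t(\omega)$ denotes a jointly measurable representative, and $(\omega,t)\mapsto\overline Z_{n+1,t}(\omega)$ a jointly measurable version of the conditional expectations. Convergence is in the norm $\|\cdot\|_B$.
   Formalization: It is additionally assumed that λ_n(Y_0,…,Y_n) is σ(Z_j : j≤n)-measurable for every n (automatic when G and all λ_n are Borel); for arbitrary non-measurable λ_n the claim as stated is false. *)

theory Defs
  imports "HOL-Probability.Probability"
begin

abbreviation unit_leb :: "real measure"
  where "unit_leb \<equiv> lebesgue_on {0..1}"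

definition ae_eq :: "(real \<Rightarrow> real ^ 'd) \<Rightarrow> (real \<Rightarrow> real ^ 'd) \<Rightarrow> bool"
  where "ae_eq f g \<longleftrightarrow> f \<in> borel_measurable unit_leb \<and> g \<in> borel_measurable unit_leb \<and>
           (AE t in unit_leb. f t = g t)"

lemma part_equivp_ae_eq: "part_equivp ae_eq"
proof (rule part_equivpI)
  show "\<exists>f. ae_eq f f"
    by (rule exI[of _ "\<lambda>_. 0"]) (simp add: ae_eq_def)
  show "symp ae_eq"
    by (rule sympI) (auto simp: ae_eq_def)
  show "transp ae_eq"
    by (rule transpI) (auto simp: ae_eq_def)
qed

text \<open>Measurable maps from the unit interval to \<open>\<real>\<^sup>d\<close> modulo almost everywhere equality. This type does not
  depend on \<open>p\<close>; every \<open>L\<^sup>p\<close> space is a subset of it.\<close>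

quotient_type 'd mfun = "real \<Rightarrow> real ^ 'd" / partial: ae_eq
  by (rule part_equivp_ae_eq)

instantiation mfun :: (finite) real_vector
begin

lift_definition zero_mfun :: "'a mfun" is "\<lambda>t. 0"
  by (simp add: ae_eq_def)

lift_definition plus_mfun :: "'a mfun \<Rightarrow> 'a mfun \<Rightarrow> 'a mfun" is "\<lambda>f g t. f t + g t"
  by (auto simp: ae_eq_def)

lift_definition minus_mfun :: "'a mfun \<Rightarrow> 'a mfun \<Rightarrow> 'a mfun" is "\<lambda>f g t. f t - g t"
  by (auto simp: ae_eq_def)

lift_definition uminus_mfun :: "'a mfun \<Rightarrow> 'a mfun" is "\<lambda>f t. - f t"
  by (auto simp: ae_eq_def)

lift_definition scaleR_mfun :: "real \<Rightarrow> 'a mfun \<Rightarrow> 'a mfun" is "\<lambda>c f t. c *\<^sub>R f t"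
  by (auto simp: ae_eq_def)

instance
proof
  fix x y z :: "'a mfun" and a b :: real
  show "x + y + z = x + (y + z)" by transfer (simp add: ae_eq_def add.assoc)
  show "x + y = y + x" by transfer (simp add: ae_eq_def add.commute)
  show "0 + x = x" by transfer (simp add: ae_eq_def)
  show "- x + x = 0" by transfer (simp add: ae_eq_def)
  show "x - y = x + - y" by transfer (simp add: ae_eq_def)
  show "a *\<^sub>R (x + y) = a *\<^sub>R x + a *\<^sub>R y" by transfer (simp add: ae_eq_def scaleR_add_right)
  show "(a + b) *\<^sub>R x = a *\<^sub>R x + b *\<^sub>R x" by transfer (simp add: ae_eq_def scaleR_add_left)
  show "a *\<^sub>R b *\<^sub>R x = (a * b) *\<^sub>R x" by transfer (simp add: ae_eq_def)
  show "1 *\<^sub>R x = x" by transfer (simp add: ae_eq_def)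
qed

end

lemma ae_eq_AE_powr:
  assumes "ae_eq f g"
  shows "AE t in unit_leb. norm (f t) powr p = norm (g t) powr p"
  using assms by (auto simp: ae_eq_def)

lemma ae_eq_measurable:
  assumes "ae_eq f g"
  shows "(\<lambda>t. norm (f t) powr p) \<in> borel_measurable unit_leb"
    and "(\<lambda>t. norm (g t) powr p) \<in> borel_measurable unit_leb"
  using assms by (auto simp: ae_eq_def)

lift_definition in_Lp :: "real \<Rightarrow> ('d::finite) mfun \<Rightarrow> bool"
  is "\<lambda>p f. integrable unit_leb (\<lambda>t. norm (f t) powr p)"
  by (intro integrable_cong_AE ae_eq_AE_powr ae_eq_measurable)

lift_definition Lp_norm :: "real \<Rightarrow> ('d::finite) mfun \<Rightarrow> real"
  is "\<lambda>p f. (\<integral>t. norm (f t) powr p \<partial>unit_leb) powr (1 / p)"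
  by (intro arg_cong[where f = "\<lambda>r. r powr _"] integral_cong_AE ae_eq_AE_powr ae_eq_measurable)

definition Lp :: "real \<Rightarrow> ('d::finite) mfun set"
  where "Lp p = {x. in_Lp p x}"

definition Lp_open :: "real \<Rightarrow> ('d::finite) mfun set \<Rightarrow> bool"
  where "Lp_open p U \<longleftrightarrow> U \<subseteq> Lp p \<and>
           (\<forall>x\<in>U. \<exists>e>0. \<forall>y\<in>Lp p. Lp_norm p (y - x) < e \<longrightarrow> y \<in> U)"

definition Lp_borel :: "real \<Rightarrow> ('d::finite) mfun measure"
  where "Lp_borel p = sigma (Lp p) {U. Lp_open p U}"

definition history ::
    "'w measure \<Rightarrow> real \<Rightarrow> (nat \<Rightarrow> 'w \<Rightarrow> ('d::finite) mfun) \<Rightarrow> nat \<Rightarrow> 'w measure"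
  where "history M p Z n =
           sigma (space M) (\<Union>j\<le>n. {Z j -` A \<inter> space M |A. A \<in> sets (Lp_borel p)})"

text \<open>\<open>z\<close> is a jointly measurable representative of the random element \<open>X\<close>. The sections
  \<open>z \<omega>\<close> are then measurable, so \<open>abs_mfun (z \<omega>)\<close> is their class.\<close>

definition representative ::
    "'w measure \<Rightarrow> ('w \<Rightarrow> real \<Rightarrow> real ^ 'd) \<Rightarrow> ('w \<Rightarrow> ('d::finite) mfun) \<Rightarrow> bool"
  where "representative M z X \<longleftrightarrow>
           (\<lambda>(\<omega>, t). z \<omega> t) \<in> borel_measurable (M \<Otimes>\<^sub>M unit_leb) \<and>
           (\<forall>\<omega>\<in>space M. abs_mfun (z \<omega>) = X \<omega>)"

text \<open>\<open>v\<close> is a jointly measurable version of the conditional expectations \<open>E[u\<^sub>t | F]\<close>. They are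
  taken componentwise because \<^const>\<open>real_cond_exp\<close> is real-valued.\<close>

definition cond_exp_version ::
    "'w measure \<Rightarrow> 'w measure \<Rightarrow> ('w \<Rightarrow> real \<Rightarrow> real ^ 'd) \<Rightarrow> ('w \<Rightarrow> real \<Rightarrow> real ^ ('d::finite)) \<Rightarrow> bool"
  where "cond_exp_version M F u v \<longleftrightarrow>
           (\<lambda>(\<omega>, t). v \<omega> t) \<in> borel_measurable (M \<Otimes>\<^sub>M unit_leb) \<and>
           (AE t in unit_leb. \<forall>i. AE \<omega> in M. v \<omega> t $ i = real_cond_exp M F (\<lambda>\<omega>. u \<omega> t $ i) \<omega>)"

text \<open>Finiteness of the expectation is part of the bound: a Bochner integral that does not exist
  has the value \<open>0\<close>.\<close>

definition expectation_le :: "'w measure \<Rightarrow> ('w \<Rightarrow> real) \<Rightarrow> real \<Rightarrow> bool"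
  where "expectation_le M f c \<longleftrightarrow> integrable M f \<and> (\<integral>\<omega>. f \<omega> \<partial>M) \<le> c"

end

(* With e_n = Y_n - x* and a_n = theta * alpha_n the recursion is
     e_{n+1} = (1 - a_n) e_n - a_n R_n - alpha_n lambda_n Z_{n+1},   |R_n| <= rho |e_n|.
   Let nu_n be the running maximum of 1 and |lambda_k|, k <= n. The normalized sums
   S_n = sum_{k<n} alpha_k (lambda_k / nu_k) Z_{k+1} are almost surely Cauchy in L^p: split Z_{k+1} into
   the part where |alpha_k Z_{k+1}| >= 1, the conditional mean of the rest, and a martingale difference.
   The first two are summable in norm; for the third, Doob's L^2 inequality at almost every t, integrated
   over t, controls the supremum of the L^2([0,1]) norms, which dominate the L^p norms as p <= 2.
   Since S is Cauchy, the noise accumulated from a late time m up to n is at most eta nu_n, and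
   nu_n grows at most linearly in max |e_k|. For small eta this bounds e, hence nu, and then the contraction
   drives e to 0, since sum a_n diverges. *)
theory Submission
  imports Defs
begin

text \<open>Dividing by \<open>\<nu>\<close> breaks a circle: the noise is multiplied by
  \<lambda>_n, which is controlled only through the iterates that this noise drives. The weights
  \<lambda>_n / \<nu>_n are at most 1 in modulus and known at time n, so S can be treated before any
  bound on Y exists. Since \<open>\<nu>\<close> is nondecreasing, it can be restored afterwards with
  nonnegative weights.

  For p < 2 the space is not a Hilbert space, so orthogonality of martingale differences is used for
  real variables at a fixed t. This requires Z_{n+1,t} to be measurable for the history at almost
  every t, whereas the history is generated by classes of functions, on which evaluation at t has no
  meaning. Integrals over intervals do depend on the class alone, and Lebesgue differentiation
  recovers almost every section from them.

  Cutting at 1/\<alpha>_n makes the scaled increments bounded. All expectations in Doob's argument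
  then exist, and the martingale property is needed only against bounded functions of the
  past.\<close>

section \<open>Driven contractions in seminormed spaces\<close>

text \<open>The carrier set is there because \<open>mfun\<close> is one type for all p. Outside
  \<open>Lp p\<close> the integral has the default value 0 and the triangle inequality for
  \<open>Lp_norm p\<close> can fail.\<close>

locale seminormed_subspace =
  fixes V :: "'a::real_vector set" and N :: "'a \<Rightarrow> real"
  assumes subspace_carrier: "subspace V"
    and triangle: "\<And>x y. x \<in> V \<Longrightarrow> y \<in> V \<Longrightarrow> N (x + y) \<le> N x + N y"
    and homogeneous: "\<And>c x. x \<in> V \<Longrightarrow> N (c *\<^sub>R x) = \<bar>c\<bar> * N x"
begin

lemma add_closed: "x \<in> V \<Longrightarrow> y \<in> V \<Longrightarrow> x + y \<in> V"
  and scale_closed: "x \<in> V \<Longrightarrow> c *\<^sub>R x \<in> V"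
  and diff_closed: "x \<in> V \<Longrightarrow> y \<in> V \<Longrightarrow> x - y \<in> V"
  and zero_closed: "0 \<in> V"
  and sum_closed: "(\<And>i. i \<in> A \<Longrightarrow> f i \<in> V) \<Longrightarrow> sum f A \<in> V"
  using subspace_carrier
  by (auto simp: subspace_add subspace_scale subspace_diff subspace_0 subspace_sum)

lemma seminorm_zero: "N 0 = 0"
  using homogeneous[OF zero_closed, of 0] by simp

lemma seminorm_minus: "x \<in> V \<Longrightarrow> N (- x) = N x"
  using homogeneous[of x "-1"] by simp

lemma seminorm_nonneg: "x \<in> V \<Longrightarrow> 0 \<le> N x"
  using triangle[of x "- x"] seminorm_minus[of x] seminorm_zero scale_closed[of x "-1"] by simp

lemma triangle_diff: "x \<in> V \<Longrightarrow> y \<in> V \<Longrightarrow> N (x - y) \<le> N x + N y"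
  using triangle[of x "- y"] seminorm_minus[of y] scale_closed[of y "-1"] by simp

lemma seminorm_sum:
  "finite A \<Longrightarrow> (\<And>i. i \<in> A \<Longrightarrow> f i \<in> V) \<Longrightarrow> N (sum f A) \<le> (\<Sum>i\<in>A. N (f i))"
proof (induction A rule: finite_induct)
  case (insert a A)
  then have "N (f a + sum f A) \<le> N (f a) + N (sum f A)" by (intro triangle sum_closed) auto
  with insert show ?case by fastforce
qed (simp add: seminorm_zero)

end

text \<open>In the application \<open>e\<^sub>n = Y\<^sub>n - x\<^sup>*\<close>, the gain \<open>\<nu>\<close> is the running maximum of 1 and \<open>\<bar>\<lambda>\<bar>\<close>, and \<open>S\<close> sums the noise
  divided by \<open>\<nu>\<close>: the convergence of \<open>S\<close> is then independent of the growth of \<open>\<lambda>\<close>.\<close>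

locale driven_contraction = seminormed_subspace V N
  for V :: "'a::real_vector set" and N +
  fixes a \<nu> :: "nat \<Rightarrow> real" and e R S :: "nat \<Rightarrow> 'a" and \<rho> :: real
  assumes e_in: "\<And>n. e n \<in> V" and R_in: "\<And>n. R n \<in> V" and S_in: "\<And>n. S n \<in> V"
    and recursion: "\<And>n. e (Suc n) = (1 - a n) *\<^sub>R e n - a n *\<^sub>R R n - \<nu> n *\<^sub>R (S (Suc n) - S n)"
    and R_bound: "\<And>n. N (R n) \<le> \<rho> * N (e n)"
    and \<rho>_range: "0 < \<rho>" "\<rho> < 1"
    and a_pos: "\<And>n. 0 < a n"
    and \<nu>_mono: "mono \<nu>" and \<nu>_nonneg: "\<And>n. 0 \<le> \<nu> n"
begin

text \<open>The response of the linear part of the recursion to the noise after time m, started at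
  rest. Its sign is chosen so that adding it to \<open>e\<close> cancels the noise.\<close>

primrec noise_from :: "nat \<Rightarrow> nat \<Rightarrow> 'a" where
  "noise_from m 0 = 0"
| "noise_from m (Suc k) = (1 - a (m + k)) *\<^sub>R noise_from m k + \<nu> (m + k) *\<^sub>R (S (Suc (m + k)) - S (m + k))"

lemma noise_from_in: "noise_from m k \<in> V"
  by (induction k) (auto intro!: add_closed scale_closed diff_closed S_in zero_closed)

text \<open>The bound is proved for the response to \<open>S\<close> frozen at every later time \<open>j\<close>; this
  replaces a summation by parts.\<close>

lemma noise_from_lookahead:
  assumes a_le: "\<And>n. m \<le> n \<Longrightarrow> a n \<le> 1"
    and cauchy: "\<And>i j. m \<le> i \<Longrightarrow> i \<le> j \<Longrightarrow> N (S j - S i) \<le> \<eta>"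
    and "m + k \<le> j"
  shows "N (noise_from m k + \<nu> (m + k) *\<^sub>R (S j - S (m + k))) \<le> \<nu> (m + k) * \<eta>"
  using \<open>m + k \<le> j\<close>
proof (induction k)
  case 0
  have "N (\<nu> m *\<^sub>R (S j - S m)) = \<nu> m * N (S j - S m)"
    using homogeneous[of "S j - S m" "\<nu> m"] \<nu>_nonneg[of m] by (simp add: diff_closed S_in)
  with 0 cauchy[of m j] \<nu>_nonneg[of m] show ?case by (simp add: mult_left_mono)
next
  case (Suc k)
  define n where "n = m + k"
  have n: "m \<le> n" "n \<le> j" "Suc n \<le> j" using Suc.prems by (auto simp: n_def)
  define U where "U = noise_from m k + \<nu> n *\<^sub>R (S j - S n)"
  have IH: "N U \<le> \<nu> n * \<eta>" using Suc by (simp add: U_def n_def)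
  have U_in: "U \<in> V" unfolding U_def by (intro add_closed scale_closed diff_closed S_in noise_from_in)
  \<comment> \<open>The weights (1 - a n) \<nu>_n, a n \<nu>_n and \<nu>_{n+1} - \<nu>_n are
    nonnegative and sum to \<nu>_{n+1}. Each comes with a factor \<eta>, the first through the
    induction hypothesis. This is where the monotonicity of \<open>\<nu>\<close> enters.\<close>
  have split: "noise_from m (Suc k) + \<nu> (Suc n) *\<^sub>R (S j - S (Suc n)) =
     ((1 - a n) *\<^sub>R U + (a n * \<nu> n) *\<^sub>R (S j - S n)) + (\<nu> (Suc n) - \<nu> n) *\<^sub>R (S j - S (Suc n))"
    unfolding U_def noise_from.simps n_def[symmetric] by (simp add: algebra_simps)
  have "N (noise_from m (Suc k) + \<nu> (Suc n) *\<^sub>R (S j - S (Suc n)))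
     \<le> N ((1 - a n) *\<^sub>R U) + N ((a n * \<nu> n) *\<^sub>R (S j - S n)) + N ((\<nu> (Suc n) - \<nu> n) *\<^sub>R (S j - S (Suc n)))"
    unfolding split
    by (intro order_trans[OF triangle] add_mono triangle order_refl add_closed scale_closed diff_closed S_in U_in)
  also have "\<dots> = (1 - a n) * N U + a n * \<nu> n * N (S j - S n) + (\<nu> (Suc n) - \<nu> n) * N (S j - S (Suc n))"
    using homogeneous[OF U_in, of "1 - a n"] homogeneous[OF diff_closed[OF S_in S_in], of "a n * \<nu> n" j n]
      homogeneous[OF diff_closed[OF S_in S_in], of "\<nu> (Suc n) - \<nu> n" j "Suc n"]
      a_le[OF n(1)] a_pos[of n] \<nu>_nonneg[of n] monoD[OF \<nu>_mono, of n "Suc n"] by simp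
  also have "\<dots> \<le> (1 - a n) * (\<nu> n * \<eta>) + a n * \<nu> n * \<eta> + (\<nu> (Suc n) - \<nu> n) * \<eta>"
    using a_le[OF n(1)] a_pos[of n] \<nu>_nonneg[of n] monoD[OF \<nu>_mono, of n "Suc n"] IH n
    by (intro add_mono mult_left_mono cauchy) auto
  also have "\<dots> = \<nu> (Suc n) * \<eta>" by (simp add: algebra_simps)
  finally show ?case by (simp add: n_def)
qed

text \<open>The sum f of \<open>e\<close> and \<open>noise_from\<close> obeys the recursion without
  noise, and R is bounded by \<rho> (|f| + W \<eta>). The resulting affine estimate for |f| has the
  fixed point \<rho> W \<eta> / (1 - \<rho>) for every step size, and the excess over it shrinks by
  the factor 1 - (1 - \<rho>) a n. Going back from f to e costs W \<eta>; the two constants add up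
  to W \<eta> / (1 - \<rho>).\<close>

lemma error_from:
  assumes a_le: "\<And>n. m \<le> n \<Longrightarrow> a n \<le> 1"
    and cauchy: "\<And>i j. m \<le> i \<Longrightarrow> i \<le> j \<Longrightarrow> N (S j - S i) \<le> \<eta>"
    and W: "\<nu> (m + k) \<le> W"
  shows "N (e (m + k)) \<le> W * \<eta> / (1 - \<rho>) + exp (- (1 - \<rho>) * (\<Sum>i<k. a (m + i))) * N (e m)"
proof -
  have \<eta>: "0 \<le> \<eta>" using cauchy[of m m] seminorm_zero by simp
  define f where "f k = e (m + k) + noise_from m k" for k
  have f_in: "f k \<in> V" for k unfolding f_def by (intro add_closed e_in noise_from_in)
  have noise: "N (noise_from m k) \<le> \<nu> (m + k) * \<eta>" for k
  proof -
    have "N (noise_from m k + \<nu> (m + k) *\<^sub>R (S (m + k) - S (m + k))) \<le> \<nu> (m + k) * \<eta>"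
      by (rule noise_from_lookahead; (assumption | rule a_le cauchy order_refl))
    then show ?thesis by simp
  qed
  have e_le: "N (e (m + k)) \<le> N (f k) + \<nu> (m + k) * \<eta>" for k
  proof -
    have "e (m + k) = f k - noise_from m k" by (simp add: f_def)
    then have "N (e (m + k)) \<le> N (f k) + N (noise_from m k)" using triangle_diff[OF f_in noise_from_in] by metis
    with noise[of k] show ?thesis by simp
  qed
  have main: "N (f k) \<le> \<rho> * W * \<eta> / (1 - \<rho>) + exp (- (1 - \<rho>) * (\<Sum>i<k. a (m + i))) * N (e m)"
    if "\<nu> (m + k) \<le> W" for k
    using that
  proof (induction k)
    case 0
    have "0 \<le> \<rho> * W * \<eta> / (1 - \<rho>)" using \<rho>_range \<eta> 0 \<nu>_nonneg[of m]
      by (intro divide_nonneg_pos mult_nonneg_nonneg) auto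
    then show ?case by (simp add: f_def)
  next
    case (Suc k)
    define n where "n = m + k"
    have a1: "a n \<le> 1" "0 < a n" using a_le a_pos by (auto simp: n_def)
    have W: "\<nu> n \<le> W" using monoD[OF \<nu>_mono, of n "Suc n"] Suc.prems by (simp add: n_def)
    define B where "B = exp (- (1 - \<rho>) * (\<Sum>i<k. a (m + i))) * N (e m)"
    have B: "0 \<le> B" unfolding B_def using seminorm_nonneg[OF e_in] by simp
    have IH: "N (f k) \<le> \<rho> * W * \<eta> / (1 - \<rho>) + B" using Suc.IH W by (simp add: n_def B_def)
    have "f (Suc k) = (1 - a n) *\<^sub>R f k - a n *\<^sub>R R n"
      unfolding f_def n_def[symmetric] noise_from.simps add_Suc_right recursion by (simp add: algebra_simps)
    then have "N (f (Suc k)) \<le> N ((1 - a n) *\<^sub>R f k) + N (a n *\<^sub>R R n)"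
      by (simp add: triangle_diff scale_closed f_in R_in)
    also have "\<dots> = (1 - a n) * N (f k) + a n * N (R n)"
      using a1 by (simp add: homogeneous f_in R_in)
    also have "\<dots> \<le> (1 - a n) * N (f k) + a n * (\<rho> * (N (f k) + W * \<eta>))"
      using a1 \<rho>_range R_bound[of n] e_le[of k] mult_right_mono[OF W \<eta>]
      by (intro add_left_mono mult_left_mono order_trans[OF R_bound]) (auto simp: n_def)
    also have "\<dots> = (1 - (1 - \<rho>) * a n) * N (f k) + a n * \<rho> * W * \<eta>" by (simp add: algebra_simps)
    also have "\<dots> \<le> (1 - (1 - \<rho>) * a n) * (\<rho> * W * \<eta> / (1 - \<rho>) + B) + a n * \<rho> * W * \<eta>"
    proof -
      have "(1 - \<rho>) * a n \<le> 1" using a1 \<rho>_range by (simp add: mult_le_one)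
      then show ?thesis by (intro add_right_mono mult_left_mono IH) auto
    qed
    also have "\<dots> = \<rho> * W * \<eta> / (1 - \<rho>) + (1 - (1 - \<rho>) * a n) * B"
      using \<rho>_range by (simp add: field_simps)
    also have "\<dots> \<le> \<rho> * W * \<eta> / (1 - \<rho>) + exp (- ((1 - \<rho>) * a n)) * B"
      using exp_ge_add_one_self[of "- ((1 - \<rho>) * a n)"] B by (intro add_left_mono mult_right_mono) auto
    also have "exp (- ((1 - \<rho>) * a n)) * B = exp (- (1 - \<rho>) * (\<Sum>i<Suc k. a (m + i))) * N (e m)"
      by (simp add: B_def n_def exp_add[symmetric] algebra_simps)
    finally show ?case .
  qed
  have "N (e (m + k)) \<le> N (f k) + W * \<eta>"
    using e_le[of k] mult_right_mono[OF W \<eta>] by linarith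
  also have "\<dots> \<le> (\<rho> * W * \<eta> / (1 - \<rho>) + exp (- (1 - \<rho>) * (\<Sum>i<k. a (m + i))) * N (e m)) + W * \<eta>"
    using main[OF W] by simp
  also have "\<dots> = W * \<eta> / (1 - \<rho>) + exp (- (1 - \<rho>) * (\<Sum>i<k. a (m + i))) * N (e m)"
    using \<rho>_range by (simp add: field_simps)
  finally show ?thesis .
qed

text \<open>\<open>error_from\<close> is used twice. First W is the gain itself, which the running
  maximum of the error bounds; a small \<eta> lets this maximum be absorbed, so the gain is bounded.
  Then W is a constant, \<eta> is as small as desired, and the divergent sum of step sizes removes
  the influence of the starting error.\<close>

lemma error_tendsto_zero:
  assumes a_lim: "a \<longlonglongrightarrow> 0"
    and a_sum: "filterlim (\<lambda>n. \<Sum>i<n. a i) at_top sequentially"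
    and cauchy: "\<And>\<eta>. 0 < \<eta> \<Longrightarrow> \<exists>m. \<forall>i j. m \<le> i \<longrightarrow> i \<le> j \<longrightarrow> N (S j - S i) \<le> \<eta>"
    and gain: "\<And>n. \<nu> n \<le> D * (1 + Max ((\<lambda>k. N (e k)) ` {..n}))" and D: "0 < D"
  shows "(\<lambda>n. N (e n)) \<longlonglongrightarrow> 0"
proof -
  \<comment> \<open>In the application a n is \<theta> \<alpha>_n, which may exceed 1 at first; all
    estimates therefore start at or after \<open>m0\<close>.\<close>
  have "eventually (\<lambda>n. a n \<le> 1) sequentially"
    by (rule eventually_mono[OF order_tendstoD(2)[OF a_lim, of 1]]) auto
  then obtain m0 where m0: "\<And>n. m0 \<le> n \<Longrightarrow> a n \<le> 1"
    unfolding eventually_sequentially by blast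
  have start: "\<exists>m\<ge>m0. \<forall>i j. m \<le> i \<longrightarrow> i \<le> j \<longrightarrow> N (S j - S i) \<le> \<eta>" if "0 < \<eta>" for \<eta>
  proof -
    obtain m where "\<forall>i j. m \<le> i \<longrightarrow> i \<le> j \<longrightarrow> N (S j - S i) \<le> \<eta>" using cauchy[OF \<open>0 < \<eta>\<close>] by blast
    then have "m0 \<le> max m m0 \<and> (\<forall>i j. max m m0 \<le> i \<longrightarrow> i \<le> j \<longrightarrow> N (S j - S i) \<le> \<eta>)" by simp
    then show ?thesis by blast
  qed
  define E where "E n = Max ((\<lambda>k. N (e k)) ` {..n})" for n
  have E_ge: "N (e k) \<le> E n" if "k \<le> n" for k n
    unfolding E_def using that by (intro Max_ge) auto
  have E_le: "E n \<le> c" if "\<And>k. k \<le> n \<Longrightarrow> N (e k) \<le> c" for n c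
    unfolding E_def using that by (subst Max_le_iff) auto
  have "\<exists>W. \<forall>n. \<nu> n \<le> W"
  proof -
    \<comment> \<open>With W = D (1 + E n) this choice makes W \<eta> / (1 - \<rho>) equal to (1 + E
      n) / 2, so E n returns with the factor 1/2.\<close>
    define \<eta> where "\<eta> = (1 - \<rho>) / (2 * D)"
    have \<eta>: "0 < \<eta>" using \<rho>_range D by (simp add: \<eta>_def)
    obtain m where m: "m0 \<le> m" and ex: "\<forall>i j. m \<le> i \<longrightarrow> i \<le> j \<longrightarrow> N (S j - S i) \<le> \<eta>"
      using start[OF \<eta>] by auto
    have late: "N (e n) \<le> (1 + E n) / 2 + E m" if "m \<le> n" for n
    proof -
      obtain k where n: "n = m + k" using le_Suc_ex[OF \<open>m \<le> n\<close>] by blast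
      have "(\<rho> - 1) * (\<Sum>i<k. a (m + i)) \<le> 0"
        using \<rho>_range a_pos by (intro mult_nonpos_nonneg sum_nonneg) (auto simp: less_imp_le)
      then have decay: "exp (- (1 - \<rho>) * (\<Sum>i<k. a (m + i))) \<le> 1" by simp
      have "N (e (m + k)) \<le> \<nu> (m + k) * \<eta> / (1 - \<rho>) + exp (- (1 - \<rho>) * (\<Sum>i<k. a (m + i))) * N (e m)"
        using m m0 ex by (intro error_from) auto
      also have "\<dots> \<le> (D * (1 + E (m + k))) * \<eta> / (1 - \<rho>) + 1 * E m"
        using \<rho>_range \<eta> gain[of "m + k"] decay E_ge[of m m] seminorm_nonneg[OF e_in, of m]
        by (intro add_mono divide_right_mono mult_right_mono mult_mono)
           (simp_all add: E_def)
      also have "\<dots> = (1 + E n) / 2 + E m" using D \<rho>_range by (simp add: \<eta>_def n field_simps)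
      finally show ?thesis by (simp add: n)
    qed
    \<comment> \<open>Times before m are covered by E m, the others by \<open>late\<close>; the
      resulting inequality is solved for E n.\<close>
    have "E n \<le> 1 + 2 * E m" for n
    proof -
      have E0: "0 \<le> E k" for k using E_ge[of 0 k] seminorm_nonneg[OF e_in, of 0] by simp
      have "E n \<le> (1 + E n) / 2 + E m"
      proof (rule E_le)
        fix k assume "k \<le> n"
        have "E k \<le> E n" by (rule E_le) (use \<open>k \<le> n\<close> E_ge in auto)
        show "N (e k) \<le> (1 + E n) / 2 + E m"
        proof (cases "m \<le> k")
          case True
          with late[OF True] \<open>E k \<le> E n\<close> show ?thesis by argo
        next
          case False
          then have "N (e k) \<le> E m" by (intro E_ge) simp
          with E0[of n] show ?thesis by argo
        qed
      qed
      then show ?thesis by argo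
    qed
    then have "D * (1 + E n) \<le> D * (1 + (1 + 2 * E m))" for n
      using D by (intro mult_left_mono add_left_mono) auto
    then have "\<nu> n \<le> D * (1 + (1 + 2 * E m))" for n
      using gain[of n] unfolding E_def[symmetric] by (rule order_trans[rotated])
    then show ?thesis by blast
  qed
  then obtain W where W: "\<And>n. \<nu> n \<le> W" by blast
  have W0: "0 \<le> W" using W[of 0] \<nu>_nonneg[of 0] by simp
  show ?thesis
  proof (rule LIMSEQ_I)
    fix r :: real assume r: "0 < r"
    \<comment> \<open>W + 1 instead of W keeps the denominator positive for W = 0 and makes the
      noise term strictly smaller than r / 2.\<close>
    define \<eta> where "\<eta> = r * (1 - \<rho>) / (2 * (W + 1))"
    have \<eta>: "0 < \<eta>" using r \<rho>_range W0 by (simp add: \<eta>_def)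
    obtain m where m: "m0 \<le> m" and ex: "\<forall>i j. m \<le> i \<longrightarrow> i \<le> j \<longrightarrow> N (S j - S i) \<le> \<eta>"
      using start[OF \<eta>] by auto
    have small: "W * \<eta> / (1 - \<rho>) < r / 2"
    proof -
      have "W * \<eta> / (1 - \<rho>) = (r / 2) * (W / (W + 1))" using \<rho>_range by (simp add: \<eta>_def)
      also have "\<dots> < (r / 2) * 1" using r W0 by (intro mult_strict_left_mono) auto
      finally show ?thesis by simp
    qed
    have "filterlim (\<lambda>k. \<Sum>i<k. a (m + i)) at_top sequentially"
    proof -
      have "(\<Sum>i<k. a (m + i)) = (- (\<Sum>i<m. a i)) + (\<Sum>i<k + m. a i)" for k
        by (induction k) (simp_all add: add.commute)
      moreover have "filterlim (\<lambda>k. (- (\<Sum>i<m. a i)) + (\<Sum>i<k + m. a i)) at_top sequentially"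
        by (intro filterlim_tendsto_add_at_top[OF tendsto_const]
            filterlim_compose[OF a_sum filterlim_add_const_nat_at_top])
      ultimately show ?thesis by simp
    qed
    then have "filterlim (\<lambda>k. - ((1 - \<rho>) * (\<Sum>i<k. a (m + i)))) at_bot sequentially"
      using \<rho>_range by (simp add: filterlim_uminus_at_bot filterlim_tendsto_pos_mult_at_top[OF tendsto_const])
    then have "(\<lambda>k. exp (- ((1 - \<rho>) * (\<Sum>i<k. a (m + i)))) * N (e m)) \<longlonglongrightarrow> 0"
      by (intro tendsto_mult_left_zero filterlim_compose[OF exp_at_bot])
    then have "eventually (\<lambda>k. exp (- ((1 - \<rho>) * (\<Sum>i<k. a (m + i)))) * N (e m) < r / 2) sequentially"
      using r by (intro order_tendstoD(2)) auto
    then obtain k0 where k0: "\<And>k. k0 \<le> k \<Longrightarrow> exp (- ((1 - \<rho>) * (\<Sum>i<k. a (m + i)))) * N (e m) < r / 2"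
      by (auto simp: eventually_sequentially)
    have "norm (N (e n) - 0) < r" if n: "m + k0 \<le> n" for n
    proof -
      obtain k where k: "n = m + k" "k0 \<le> k" using n by (metis add.assoc le_Suc_ex le_add1)
      have "N (e (m + k)) \<le> W * \<eta> / (1 - \<rho>) + exp (- (1 - \<rho>) * (\<Sum>i<k. a (m + i))) * N (e m)"
        using m m0 ex W by (intro error_from) auto
      with k0[OF k(2)] small have "N (e n) < r" unfolding k(1) mult_minus_left by argo
      then show ?thesis using seminorm_nonneg[OF e_in, of n] by simp
    qed
    then show "\<exists>no. \<forall>n\<ge>no. norm (N (e n) - 0) < r" by blast
  qed
qed

end

section \<open>Norms on \<open>L\<^sup>p\<close>\<close>

text \<open>The counterpart of \<open>Lp_norm\<close> on functions, where the estimates are made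
  before they pass to classes. It is 0 if the integrand is not integrable, so the inequalities below
  come with statements of integrability.\<close>

definition Lnorm :: "'a measure \<Rightarrow> real \<Rightarrow> ('a \<Rightarrow> 'b::real_normed_vector) \<Rightarrow> real"
  where "Lnorm M p f = (\<integral>x. norm (f x) powr p \<partial>M) powr (1 / p)"

lemma Lnorm_nonneg: "0 \<le> Lnorm M p f"
  by (simp add: Lnorm_def)

lemma Lnorm_powr: "0 < p \<Longrightarrow> Lnorm M p f powr p = (\<integral>x. norm (f x) powr p \<partial>M)"
  by (simp add: Lnorm_def powr_powr)

lemma Lnorm_eq_0_AE:
  fixes f :: "'a \<Rightarrow> 'b::real_normed_vector"
  assumes "0 < p" "integrable M (\<lambda>x. norm (f x) powr p)" "Lnorm M p f = 0"
  shows "AE x in M. f x = 0"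
proof -
  have "(\<integral>x. norm (f x) powr p \<partial>M) = 0" using Lnorm_powr[OF assms(1), of M f] assms by simp
  then have "AE x in M. norm (f x) powr p = 0"
    using assms by (subst (asm) integral_nonneg_eq_0_iff_AE) auto
  then show ?thesis by (rule AE_mp) (auto simp: powr_eq_0_iff)
qed

text \<open>Young's inequality \<open>s \<le> (s\<^sup>r - 1) / r + 1\<close> at \<open>s = (norm (f x) / c)\<^sup>p\<close>, \<open>r = q / p\<close>, where \<open>c\<close> is the \<open>q\<close>-norm.\<close>

lemma Lnorm_mono_exponent:
  fixes f :: "'a \<Rightarrow> 'b::real_normed_vector"
  assumes M: "prob_space M" and pq: "0 < p" "p \<le> q"
    and [measurable]: "(\<lambda>x. norm (f x)) \<in> borel_measurable M"
    and int: "integrable M (\<lambda>x. norm (f x) powr q)"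
  shows "integrable M (\<lambda>x. norm (f x) powr p)" and "Lnorm M p f \<le> Lnorm M q f"
proof -
  interpret prob_space M by (rule M)
  have young: "s powr p \<le> 1 + (p / q) * (s powr q - 1)" if s: "0 \<le> s" for s :: real
  proof (cases "s = 0")
    case False
    then have "(s powr q) powr (p / q) * 1 powr (1 - p / q) \<le> (p / q) * s powr q + (1 - p / q) * 1"
      using pq by (intro Youngs_inequality_0) auto
    with pq show ?thesis by (simp add: powr_powr algebra_simps)
  qed (use pq in simp)
  show int': "integrable M (\<lambda>x. norm (f x) powr p)"
    by (rule Bochner_Integration.integrable_bound[where f="\<lambda>x. 1 + (p / q) * (norm (f x) powr q - 1)"])
      (use int young in \<open>auto intro!: AE_I2 simp: abs_of_nonneg intro: order_trans[OF _ abs_ge_self]\<close>)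
  define c where "c = Lnorm M q f"
  show "Lnorm M p f \<le> Lnorm M q f"
  proof (cases "c = 0")
    case True
    then have "AE x in M. f x = 0" using Lnorm_eq_0_AE[OF _ int] pq by (simp add: c_def)
    then have "(\<integral>x. norm (f x) powr p \<partial>M) = (\<integral>x. 0 \<partial>M)"
      by (intro integral_cong_AE) auto
    then show ?thesis by (simp add: Lnorm_def)
  next
    case False
    then have c: "0 < c" using Lnorm_nonneg[of M q f] by (simp add: c_def)
    have "(\<integral>x. (norm (f x) / c) powr p \<partial>M) \<le> (\<integral>x. 1 + (p / q) * ((norm (f x) / c) powr q - 1) \<partial>M)"
      using int int' c by (intro integral_mono young) (auto simp: powr_divide)
    also have "\<dots> = 1 + (p / q) * ((\<integral>x. norm (f x) powr q \<partial>M) / c powr q - 1)"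
      using int c by (simp add: powr_divide prob_space)
    also have "\<dots> = 1" using c pq by (simp add: Lnorm_powr[symmetric] c_def)
    finally have "(\<integral>x. norm (f x) powr p \<partial>M) \<le> c powr p"
      using c by (simp add: powr_divide divide_le_eq)
    then have "Lnorm M p f \<le> (c powr p) powr (1 / p)"
      unfolding Lnorm_def using pq by (intro powr_mono2) auto
    with pq c show ?thesis by (simp add: powr_powr c_def)
  qed
qed

text \<open>Two positive points are covered by \<open>powr_convex\<close>. If one point is 0, the
  claim reduces to \<open>c powr p\<close> \<le> c for 0 < c < 1.\<close>

lemma powr_convex_nonneg:
  assumes "1 \<le> p" shows "convex_on {0..} (\<lambda>x::real. x powr p)"
proof (rule convex_onI)
  fix t x y :: real assume t: "0 < t" "t < 1" and xy: "x \<in> {0..}" "y \<in> {0..}"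
  have scale: "(c * u) powr p \<le> c * u powr p" if "0 < c" "c < 1" "0 \<le> u" for c u :: real
  proof -
    have "c powr p \<le> c powr 1" using that assms by (intro powr_mono') auto
    then show ?thesis using that by (simp add: powr_mult mult_right_mono)
  qed
  show "((1 - t) *\<^sub>R x + t *\<^sub>R y) powr p \<le> (1 - t) * x powr p + t * y powr p"
  proof (cases "0 < x \<and> 0 < y")
    case True
    with t convex_onD[OF powr_convex[OF assms], of t x y] show ?thesis by simp
  next
    case False
    with xy have "x = 0 \<or> y = 0" by auto
    with t xy scale[of t y] scale[of "1 - t" x] assms show ?thesis by auto
  qed
qed simp

text \<open>Minkowski's inequality from convexity alone: (f + g) / (a + b) is the convex combination
  of f / a and g / b with weights a / (a + b) and b / (a + b). For a and b the two norms, the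
  integral of the right-hand side is 1.\<close>

lemma Lnorm_triangle:
  fixes f g :: "'a \<Rightarrow> 'b::{real_normed_vector, second_countable_topology}"
  assumes p: "1 \<le> p" and [measurable]: "f \<in> borel_measurable M" "g \<in> borel_measurable M"
    and f: "integrable M (\<lambda>x. norm (f x) powr p)" and g: "integrable M (\<lambda>x. norm (g x) powr p)"
  shows "integrable M (\<lambda>x. norm (f x + g x) powr p)"
    and "Lnorm M p (\<lambda>x. f x + g x) \<le> Lnorm M p f + Lnorm M p g"
proof -
  have conv: "(norm (u + v) / (a + b)) powr p
      \<le> (a / (a + b)) * (norm u / a) powr p + (b / (a + b)) * (norm v / b) powr p"
    if ab: "0 < a" "0 < b" for a b and u v :: 'b
  proof -
    have "norm (u + v) / (a + b) \<le> (1 - b / (a + b)) * (norm u / a) + (b / (a + b)) * (norm v / b)"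
    proof -
      have "1 - b / (a + b) = a / (a + b)" using ab by (simp add: field_simps)
      then show ?thesis using ab norm_triangle_ineq[of u v]
        by (simp add: add_divide_distrib[symmetric] divide_right_mono)
    qed
    then have "(norm (u + v) / (a + b)) powr p
        \<le> ((1 - b / (a + b)) *\<^sub>R (norm u / a) + (b / (a + b)) *\<^sub>R (norm v / b)) powr p"
      using ab p by (intro powr_mono2) auto
    also have "\<dots> \<le> (1 - b / (a + b)) * (norm u / a) powr p + (b / (a + b)) * (norm v / b) powr p"
      using ab by (intro convex_onD[OF powr_convex_nonneg[OF p]]) auto
    also have "1 - b / (a + b) = a / (a + b)" using ab by (simp add: field_simps)
    finally show ?thesis .
  qed
  show int: "integrable M (\<lambda>x. norm (f x + g x) powr p)"
  proof (rule Bochner_Integration.integrable_bound)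
    show "integrable M (\<lambda>x. 2 powr p * (norm (f x) powr p + norm (g x) powr p))" using f g by simp
    show "AE x in M. norm (norm (f x + g x) powr p) \<le> norm (2 powr p * (norm (f x) powr p + norm (g x) powr p))"
    proof (rule AE_I2)
      fix x
      have "norm (f x + g x) powr p \<le> 2 powr p * ((1/2) * norm (f x) powr p + (1/2) * norm (g x) powr p)"
        using conv[of 1 1 "f x" "g x"] by (simp add: powr_divide divide_le_eq algebra_simps)
      also have "\<dots> \<le> 2 powr p * (norm (f x) powr p + norm (g x) powr p)"
        by (intro mult_left_mono) (auto intro!: add_mono)
      finally show "norm (norm (f x + g x) powr p) \<le> norm (2 powr p * (norm (f x) powr p + norm (g x) powr p))"
        by simp
    qed
  qed measurable
  define a b where "a = Lnorm M p f" and "b = Lnorm M p g"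
  have ab: "0 \<le> a" "0 \<le> b" by (auto simp: a_def b_def Lnorm_nonneg)
  show "Lnorm M p (\<lambda>x. f x + g x) \<le> Lnorm M p f + Lnorm M p g"
  \<comment> \<open>A vanishing norm cannot be divided by, but then that function is 0 almost
    everywhere.\<close>
  proof (cases "a = 0 \<or> b = 0")
    case True
    then consider "AE x in M. f x = 0" | "AE x in M. g x = 0"
      using Lnorm_eq_0_AE[OF _ f] Lnorm_eq_0_AE[OF _ g] p by (auto simp: a_def b_def)
    then show ?thesis
    proof cases
      case 1
      then have "(\<integral>x. norm (f x + g x) powr p \<partial>M) = (\<integral>x. norm (g x) powr p \<partial>M)"
        by (intro integral_cong_AE) auto
      with ab show ?thesis by (simp add: Lnorm_def a_def)
    next
      case 2
      then have "(\<integral>x. norm (f x + g x) powr p \<partial>M) = (\<integral>x. norm (f x) powr p \<partial>M)"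
        by (intro integral_cong_AE) auto
      with ab show ?thesis by (simp add: Lnorm_def b_def)
    qed
  next
    case False
    with ab have pos: "0 < a" "0 < b" by auto
    have "(\<integral>x. (norm (f x + g x) / (a + b)) powr p \<partial>M)
        \<le> (\<integral>x. (a / (a + b)) * (norm (f x) / a) powr p + (b / (a + b)) * (norm (g x) / b) powr p \<partial>M)"
      using f g int pos by (intro integral_mono conv) (auto simp: powr_divide)
    also have "\<dots> = (a / (a + b)) * ((\<integral>x. norm (f x) powr p \<partial>M) / a powr p)
        + (b / (a + b)) * ((\<integral>x. norm (g x) powr p \<partial>M) / b powr p)"
      using f g pos by (simp add: powr_divide)
    also have "\<dots> = 1"
      using pos p by (simp add: Lnorm_powr[symmetric] a_def[symmetric] b_def[symmetric] add_divide_distrib[symmetric])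
    finally have "(\<integral>x. norm (f x + g x) powr p \<partial>M) \<le> (a + b) powr p"
      using pos by (simp add: powr_divide divide_le_eq)
    then have "Lnorm M p (\<lambda>x. f x + g x) \<le> ((a + b) powr p) powr (1 / p)"
      unfolding Lnorm_def using p by (intro powr_mono2) auto
    with pos p show ?thesis by (simp add: powr_powr a_def b_def)
  qed
qed

section \<open>Classes, their representatives, and L^p as a seminormed subspace\<close>

lemma ae_eq_refl_iff [simp]: "ae_eq f f \<longleftrightarrow> f \<in> borel_measurable unit_leb"
  by (simp add: ae_eq_def)

lemma prob_space_unit_leb: "prob_space unit_leb"
  by (rule prob_spaceI) (simp add: emeasure_restrict_space)

lemma abs_mfun_in_Lp_iff:
  "f \<in> borel_measurable unit_leb \<Longrightarrow> abs_mfun f \<in> Lp p \<longleftrightarrow> integrable unit_leb (\<lambda>t. norm (f t) powr p)"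
  by (simp add: Lp_def in_Lp.abs_eq)

lemma Lp_norm_abs_mfun:
  "f \<in> borel_measurable unit_leb \<Longrightarrow> Lp_norm p (abs_mfun f) = Lnorm unit_leb p f"
  by (simp add: Lp_norm.abs_eq Lnorm_def)

lemma plus_abs_mfun:
  "f \<in> borel_measurable unit_leb \<Longrightarrow> g \<in> borel_measurable unit_leb \<Longrightarrow>
    abs_mfun f + abs_mfun g = abs_mfun (\<lambda>t. f t + g t)"
  by (simp add: plus_mfun.abs_eq)

lemma minus_abs_mfun:
  "f \<in> borel_measurable unit_leb \<Longrightarrow> g \<in> borel_measurable unit_leb \<Longrightarrow>
    abs_mfun f - abs_mfun g = abs_mfun (\<lambda>t. f t - g t)"
  by (simp add: minus_mfun.abs_eq)

lemma scaleR_abs_mfun: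
  "f \<in> borel_measurable unit_leb \<Longrightarrow> c *\<^sub>R abs_mfun f = abs_mfun (\<lambda>t. c *\<^sub>R f t)"
  by (simp add: scaleR_mfun.abs_eq)

lemma sum_abs_mfun:
  assumes "finite A" "\<And>k. k \<in> A \<Longrightarrow> f k \<in> borel_measurable unit_leb"
  shows "(\<Sum>k\<in>A. abs_mfun (f k)) = abs_mfun (\<lambda>t. \<Sum>k\<in>A. f k t)"
  using assms
proof (induction A rule: finite_induct)
  case empty
  then show ?case by (simp add: zero_mfun.abs_eq)
next
  case (insert x F)
  then show ?case by (simp add: plus_abs_mfun borel_measurable_sum)
qed

lemma mfun_cases:
  obtains f where "x = abs_mfun f" "f \<in> borel_measurable unit_leb"
  by (induction x rule: mfun.abs_induct) (metis ae_eq_refl_iff)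

lemma seminormed_subspace_Lp:
  assumes p: "1 \<le> p"
  shows "seminormed_subspace (Lp p :: 'd::finite mfun set) (Lp_norm p)"
proof -
  have add: "x + y \<in> Lp p \<and> Lp_norm p (x + y) \<le> Lp_norm p x + Lp_norm p y"
    if "x \<in> Lp p" "y \<in> Lp p" for x y :: "'d mfun"
  proof -
    obtain f g where "x = abs_mfun f" "y = abs_mfun g" and
      [measurable]: "f \<in> borel_measurable unit_leb" "g \<in> borel_measurable unit_leb"
      by (meson mfun_cases)
    with that Lnorm_triangle[OF p, of f unit_leb g] show ?thesis
      by (simp add: plus_abs_mfun abs_mfun_in_Lp_iff Lp_norm_abs_mfun)
  qed
  have scale: "c *\<^sub>R x \<in> Lp p \<and> Lp_norm p (c *\<^sub>R x) = \<bar>c\<bar> * Lp_norm p x"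
    if "x \<in> Lp p" for c and x :: "'d mfun"
  proof -
    obtain f where "x = abs_mfun f" and [measurable]: "f \<in> borel_measurable unit_leb"
      by (meson mfun_cases)
    with that p show ?thesis
      by (simp add: scaleR_abs_mfun abs_mfun_in_Lp_iff Lp_norm_abs_mfun powr_mult Lnorm_def powr_powr)
  qed
  have "0 \<in> Lp p" by (simp add: zero_mfun.abs_eq abs_mfun_in_Lp_iff)
  then have "subspace (Lp p :: 'd mfun set)" by (simp add: subspace_def add scale)
  then show ?thesis using add scale by unfold_locales auto
qed

section \<open>Adaptedness of the sections of a representative\<close>

lemma borel_measurable_unit_leb: "f \<in> borel_measurable borel \<Longrightarrow> f \<in> borel_measurable unit_leb"
  by (intro measurable_restrict_space1 measurable_completion) simp

lemma borel_measurable_vec_nth [measurable (raw)]: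
  fixes f :: "'a \<Rightarrow> real ^ 'd::finite"
  shows "f \<in> borel_measurable M \<Longrightarrow> (\<lambda>x. f x $ i) \<in> borel_measurable M"
  by (rule measurable_compose[OF _ borel_measurable_continuous_onI]) (auto intro!: continuous_intros)

text \<open>Lebesgue differentiation along the lengths 1/(n+1): a limit of a sequence keeps the
  measurability in \<omega> that \<open>AE_section_measurable\<close> is after.\<close>

lemma lebesgue_differentiation_unit:
  fixes w :: "real \<Rightarrow> real"
  assumes [measurable]: "w \<in> borel_measurable unit_leb" and B: "\<And>t. \<bar>w t\<bar> \<le> B"
  shows "AE t in unit_leb. (\<lambda>n. (\<integral>s. indicat_real {t..t + inverse (Suc n)} s * w s \<partial>unit_leb) / inverse (Suc n)) \<longlonglongrightarrow> w t"
proof -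
  \<comment> \<open>After extension by 0 the interval from t to t + h may leave the unit interval
    without changing the integral.\<close>
  define f where "f s = indicat_real {0..1} s * w s" for s
  have f_meas [measurable]: "f \<in> borel_measurable lebesgue"
    using assms(1) unfolding f_def by (subst (asm) borel_measurable_restrict_space_iff) auto
  have "integrable lebesgue f"
  proof (rule Bochner_Integration.integrable_bound)
    have "integrable lebesgue (indicat_real {0..1 :: real})" by (simp flip: lmeasurable_iff_integrable)
    then show "integrable lebesgue (\<lambda>s::real. B * indicat_real {0..1} s)" by simp
    show "AE s in lebesgue. norm (f s) \<le> norm (B * indicat_real {0..1} s)"
      using B by (auto simp: f_def indicator_def intro!: AE_I2 order_trans[OF B abs_ge_self])
  qed simp
  have set_int: "set_integrable lebesgue {a..b} f" for a b :: real
    unfolding set_integrable_def using \<open>integrable lebesgue f\<close>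
    by (intro integrable_mult_indicator) auto
  have int: "integral (cbox a b) f = (\<integral>s. indicat_real {a..b} s * w s \<partial>unit_leb)" for a b
  proof -
    have "integral (cbox a b) f = (LINT s:{a..b}|lebesgue. f s)"
      using set_lebesgue_integral_eq_integral(2)[OF set_int] by simp
    also have "\<dots> = (\<integral>s. indicat_real {0..1} s *\<^sub>R (indicat_real {a..b} s * w s) \<partial>lebesgue)"
      by (simp add: set_lebesgue_integral_def f_def mult.left_commute)
    also have "\<dots> = (\<integral>s. indicat_real {a..b} s * w s \<partial>unit_leb)"
      by (subst integral_restrict_space) auto
    finally show ?thesis .
  qed
  have "f integrable_on cbox a b" for a b
    using set_lebesgue_integral_eq_integral(1)[OF set_int] by simp
  then obtain N where N: "negligible N" and lim: "\<And>x e. \<lbrakk>x \<notin> N; 0 < e\<rbrakk> \<Longrightarrow>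
      \<exists>d>0. \<forall>h. 0 < h \<and> h < d \<longrightarrow> norm (integral (cbox x (x + h *\<^sub>R One)) f /\<^sub>R h ^ DIM(real) - f x) < e"
    by (rule integrable_ccontinuous_explicit) auto
  have "AE t in lebesgue. t \<notin> N"
    using N by (intro AE_not_in) (simp add: negligible_iff_null_sets)
  then have "AE t in unit_leb. t \<notin> N"
    by (subst AE_restrict_space_iff) (auto elim: AE_mp)
  then show ?thesis
  proof (rule AE_mp, intro AE_I2 impI)
    fix t assume t: "t \<in> space unit_leb" "t \<notin> N"
    have "((\<lambda>h. integral (cbox t (t + h)) f / h) \<longlongrightarrow> f t) (at_right 0)"
    proof (rule tendstoI)
      fix e :: real assume "0 < e"
      from lim[OF t(2) this] obtain d where "0 < d"
        "\<And>h. 0 < h \<Longrightarrow> h < d \<Longrightarrow> norm (integral (cbox t (t + h)) f / h - f t) < e"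
        by (auto simp: divide_inverse mult.commute)
      then show "\<forall>\<^sub>F h in at_right 0. dist (integral (cbox t (t + h)) f / h) (f t) < e"
        unfolding eventually_at_right_field dist_norm by blast
    qed
    moreover have "filterlim (\<lambda>n. inverse (real (Suc n))) (at_right 0) sequentially"
      by (intro filterlim_compose[OF filterlim_inverse_at_right_top]
          filterlim_compose[OF filterlim_real_sequentially filterlim_Suc])
    ultimately have "(\<lambda>n. integral (cbox t (t + inverse (real (Suc n)))) f / inverse (real (Suc n))) \<longlonglongrightarrow> f t"
      by (rule filterlim_compose)
    moreover have "f t = w t" using t by (simp add: f_def)
    ultimately show "(\<lambda>n. (\<integral>s. indicat_real {t..t + inverse (Suc n)} s * w s \<partial>unit_leb) / inverse (Suc n)) \<longlonglongrightarrow> w t"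
      unfolding int by simp
  qed
qed

text \<open>By Lebesgue differentiation almost every section is a limit of averages over shrinking intervals.\<close>

lemma AE_section_measurable:
  fixes w :: "'w \<Rightarrow> real \<Rightarrow> real"
  assumes M: "prob_space M" and F: "space F = space M"
    and w [measurable]: "(\<lambda>(\<omega>, t). w \<omega> t) \<in> borel_measurable (M \<Otimes>\<^sub>M unit_leb)"
    and B: "\<And>\<omega> t. \<bar>w \<omega> t\<bar> \<le> B"
    and avg: "\<And>a b. (\<lambda>\<omega>. \<integral>t. indicat_real {a..b} t * w \<omega> t \<partial>unit_leb) \<in> borel_measurable F"
  shows "AE t in unit_leb. \<exists>v\<in>borel_measurable F. AE \<omega> in M. w \<omega> t = v \<omega>"
proof -
  interpret M: prob_space M by (rule M)
  interpret I: prob_space unit_leb by (rule prob_space_unit_leb)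
  interpret pair_sigma_finite M unit_leb ..
  define A where "A n \<omega> t = (\<integral>s. indicat_real {t..t + inverse (Suc n)} s * w \<omega> s \<partial>unit_leb) / inverse (real (Suc n))"
    for n \<omega> t
  have [measurable]: "(\<lambda>x. x) \<in> unit_leb \<rightarrow>\<^sub>M borel"
    by (rule borel_measurable_unit_leb) simp
  have [measurable]: "(\<lambda>(\<omega>, t). A n \<omega> t) \<in> borel_measurable (M \<Otimes>\<^sub>M unit_leb)" for n
  proof -
    \<comment> \<open>As a conditional, the indicator of the moving interval is seen to be
      measurable in t and s jointly.\<close>
    have "(\<lambda>((\<omega>, t), s). (if t \<le> s \<and> s \<le> t + inverse (Suc n) then 1 else 0) * w \<omega> s)
        \<in> borel_measurable ((M \<Otimes>\<^sub>M unit_leb) \<Otimes>\<^sub>M unit_leb)"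
      unfolding split_beta by measurable
    then have "(\<lambda>(\<omega>, t). \<integral>s. (if t \<le> s \<and> s \<le> t + inverse (Suc n) then 1 else 0) * w \<omega> s \<partial>unit_leb)
        \<in> borel_measurable (M \<Otimes>\<^sub>M unit_leb)"
      unfolding split_beta by (intro I.borel_measurable_lebesgue_integral) (simp add: split_beta)
    moreover have "indicat_real {t..t + inverse (real (Suc n))} s = (if t \<le> s \<and> s \<le> t + inverse (Suc n) then 1 else 0)"
      for t s by (simp add: indicator_def)
    ultimately show ?thesis unfolding A_def split_beta by simp
  qed
  have sec: "w \<omega> \<in> borel_measurable unit_leb" if "\<omega> \<in> space M" for \<omega>
    using measurable_Pair2[OF w that] by simp
  \<comment> \<open>The total function \<open>lim\<close> is jointly measurable, so the order of the
    two null sets can be exchanged; at fixed t it is also measurable with respect to F, by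
    \<open>avg\<close>.\<close>
  have "AE \<omega> in M. AE t in unit_leb. lim (\<lambda>n. A n \<omega> t) = w \<omega> t"
  proof (rule AE_I2)
    fix \<omega> assume "\<omega> \<in> space M"
    show "AE t in unit_leb. lim (\<lambda>n. A n \<omega> t) = w \<omega> t"
      using lebesgue_differentiation_unit[OF sec[OF \<open>\<omega> \<in> space M\<close>] B]
      by (rule AE_mp) (auto simp: A_def intro!: AE_I2 limI)
  qed
  then have "AE t in unit_leb. AE \<omega> in M. lim (\<lambda>n. A n \<omega> t) = w \<omega> t"
    by (subst AE_commute[symmetric]) measurable
  then show ?thesis
  proof (rule AE_mp, intro AE_I2 impI)
    fix t assume "AE \<omega> in M. lim (\<lambda>n. A n \<omega> t) = w \<omega> t"
    then have "AE \<omega> in M. w \<omega> t = lim (\<lambda>n. A n \<omega> t)" by (rule AE_mp) simp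
    moreover have "(\<lambda>\<omega>. lim (\<lambda>n. A n \<omega> t)) \<in> borel_measurable F"
      unfolding A_def using avg by (intro borel_measurable_lim_metric) simp
    ultimately show "\<exists>v\<in>borel_measurable F. AE \<omega> in M. w \<omega> t = v \<omega>"
      by (intro bexI[of _ "\<lambda>\<omega>. lim (\<lambda>n. A n \<omega> t)"])
  qed
qed

section \<open>Averages of arctan as continuous functionals on L^p\<close>

lemma abs_arctan_diff_le: "\<bar>arctan x - arctan y\<bar> \<le> \<bar>x - y\<bar>"
proof -
  have "norm (arctan x - arctan y) \<le> 1 * norm (x - y)"
    by (rule field_differentiable_bound[of UNIV arctan "\<lambda>x. inverse (1 + x\<^sup>2)"])
      (auto intro: DERIV_arctan has_field_derivative_at_within simp: inverse_le_1_iff add_nonneg_eq_0_iff)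
  then show ?thesis by simp
qed

text \<open>The truncation by \<open>arctan\<close> makes the averages defined and continuous on every \<open>L\<^sup>p\<close>.\<close>

lift_definition arctan_average :: "real \<Rightarrow> real \<Rightarrow> 'd \<Rightarrow> ('d::finite) mfun \<Rightarrow> real"
  is "\<lambda>a b i f. \<integral>t. indicat_real {a..b} t * arctan (f t $ i) \<partial>unit_leb"
proof -
  fix a b :: real and i :: 'd and f g :: "real \<Rightarrow> real ^ 'd"
  assume fg: "ae_eq f g"
  then have [measurable]: "f \<in> borel_measurable unit_leb" "g \<in> borel_measurable unit_leb" by (auto simp: ae_eq_def)
  have [measurable]: "indicat_real {a..b} \<in> borel_measurable unit_leb"
    by (rule borel_measurable_unit_leb) simp
  show "(\<integral>t. indicat_real {a..b} t * arctan (f t $ i) \<partial>unit_leb) = (\<integral>t. indicat_real {a..b} t * arctan (g t $ i) \<partial>unit_leb)"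
    using fg by (intro integral_cong_AE) (auto simp: ae_eq_def)
qed

lemma arctan_average_abs_mfun:
  "f \<in> borel_measurable unit_leb \<Longrightarrow>
    arctan_average a b i (abs_mfun f) = (\<integral>t. indicat_real {a..b} t * arctan (f t $ i) \<partial>unit_leb)"
  by (simp add: arctan_average.abs_eq)

text \<open>arctan has Lipschitz constant 1, which gives the L^1 distance, and on a probability
  space the L^1 norm is at most the L^p norm.\<close>

lemma arctan_average_lipschitz:
  fixes x y :: "'d::finite mfun"
  assumes p: "1 \<le> p" and xy: "x \<in> Lp p" "y \<in> Lp p"
  shows "\<bar>arctan_average a b i x - arctan_average a b i y\<bar> \<le> Lp_norm p (x - y)"
proof -
  interpret I: prob_space unit_leb by (rule prob_space_unit_leb)
  interpret seminormed_subspace "Lp p :: 'd mfun set" "Lp_norm p" by (rule seminormed_subspace_Lp[OF p])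
  obtain f g where x: "x = abs_mfun f" and y: "y = abs_mfun g" and
    [measurable]: "f \<in> borel_measurable unit_leb" "g \<in> borel_measurable unit_leb"
    by (meson mfun_cases)
  have [measurable]: "indicat_real {a..b} \<in> borel_measurable unit_leb"
    by (rule borel_measurable_unit_leb) simp
  have bounded: "integrable unit_leb (\<lambda>t. indicat_real {a..b} t * arctan (h t $ i))"
    if [measurable]: "h \<in> borel_measurable unit_leb" for h :: "real \<Rightarrow> real ^ 'd"
  proof (rule I.integrable_const_bound[of _ "pi / 2"])
    have "\<bar>arctan u\<bar> \<le> pi / 2" for u using arctan_bounded[of u] by linarith
    then show "AE t in unit_leb. norm (indicat_real {a..b} t * arctan (h t $ i)) \<le> pi / 2"
      by (intro AE_I2) (simp add: abs_mult indicator_def)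
  qed measurable
  have "integrable unit_leb (\<lambda>t. norm (f t - g t) powr p)"
    using diff_closed[OF xy] by (simp add: x y minus_abs_mfun abs_mfun_in_Lp_iff)
  note L1 = Lnorm_mono_exponent[OF prob_space_unit_leb zero_less_one p _ this]
  have "\<bar>arctan_average a b i x - arctan_average a b i y\<bar> =
      \<bar>\<integral>t. indicat_real {a..b} t * arctan (f t $ i) - indicat_real {a..b} t * arctan (g t $ i) \<partial>unit_leb\<bar>"
    by (simp add: x y arctan_average_abs_mfun bounded)
  also have "\<dots> \<le> (\<integral>t. norm (f t - g t) powr 1 \<partial>unit_leb)"
  proof (rule integral_abs_bound_integral)
    fix t
    have "\<bar>arctan (f t $ i) - arctan (g t $ i)\<bar> \<le> norm (f t - g t)"
      by (rule order_trans[OF abs_arctan_diff_le]) (use component_le_norm_cart[of "f t - g t" i] in simp)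
    then show "\<bar>indicat_real {a..b} t * arctan (f t $ i) - indicat_real {a..b} t * arctan (g t $ i)\<bar>
        \<le> norm (f t - g t) powr 1"
      by (simp add: indicator_def)
  qed (use bounded L1(1) in auto)
  also have "\<dots> = Lnorm unit_leb 1 (\<lambda>t. f t - g t)" by (simp add: Lnorm_def)
  also have "\<dots> \<le> Lp_norm p (x - y)" using L1(2) by (simp add: x y minus_abs_mfun Lp_norm_abs_mfun)
  finally show ?thesis .
qed

lemma space_Lp_borel [simp]: "space (Lp_borel p) = Lp p"
  and sets_Lp_borel_open: "Lp_open p U \<Longrightarrow> U \<in> sets (Lp_borel p)"
proof -
  have *: "{U. Lp_open p U} \<subseteq> Pow (Lp p)" by (auto simp: Lp_open_def)
  show "space (Lp_borel p) = Lp p" by (simp add: Lp_borel_def space_measure_of[OF *])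
  show "U \<in> sets (Lp_borel p)" if "Lp_open p U"
    using that by (simp add: Lp_borel_def sets_measure_of[OF *])
qed

text \<open>Superlevel sets are open: on the ball about x whose radius is the excess of the value at
  x over c, the Lipschitz bound keeps the value above c.\<close>

lemma arctan_average_measurable:
  assumes p: "1 \<le> p"
  shows "arctan_average a b i \<in> borel_measurable (Lp_borel p)"
proof (subst borel_measurable_iff_greater, intro allI sets_Lp_borel_open)
  fix c
  show "Lp_open p {x \<in> space (Lp_borel p). c < arctan_average a b i x}"
    unfolding Lp_open_def
  proof (intro conjI ballI)
    fix x assume x: "x \<in> {x \<in> space (Lp_borel p). c < arctan_average a b i x}"
    show "\<exists>e>0. \<forall>y\<in>Lp p. Lp_norm p (y - x) < e \<longrightarrow> y \<in> {x \<in> space (Lp_borel p). c < arctan_average a b i x}"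
    proof (intro exI[of _ "arctan_average a b i x - c"] conjI ballI impI)
      fix y assume "y \<in> Lp p" "Lp_norm p (y - x) < arctan_average a b i x - c"
      with x arctan_average_lipschitz[OF p, of y x a b i] show "y \<in> {x \<in> space (Lp_borel p). c < arctan_average a b i x}"
        by auto
    qed (use x in auto)
  qed auto
qed

section \<open>The history as a filtration, and adapted sections\<close>

lemma history_generators:
  "(\<Union>j\<le>n. {Z j -` A \<inter> space M |A. A \<in> sets (Lp_borel p)}) \<subseteq> Pow (space M)"
  by auto

lemma space_history [simp]: "space (history M p Z n) = space M"
  by (simp add: history_def space_measure_of[OF history_generators])

lemma subalgebra_history:
  assumes "\<And>n. Z n \<in> M \<rightarrow>\<^sub>M Lp_borel p"
  shows "subalgebra M (history M p Z n)"
proof -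
  have "(\<Union>j\<le>n. {Z j -` A \<inter> space M |A. A \<in> sets (Lp_borel p)}) \<subseteq> sets M"
    using measurable_sets[OF assms] by blast
  then have "sets (history M p Z n) \<subseteq> sets M"
    unfolding history_def sets_measure_of[OF history_generators] by (rule sets.sigma_sets_subset)
  then show ?thesis by (simp add: subalgebra_def)
qed

lemma history_mono:
  assumes "m \<le> n"
  shows "sets (history M p Z m) \<subseteq> sets (history M p Z n)"
  unfolding history_def sets_measure_of[OF history_generators]
  using assms by (intro sigma_sets_mono') (auto intro: order_trans)

lemma measurable_history:
  fixes Z :: "nat \<Rightarrow> 'w \<Rightarrow> 'd::finite mfun"
  assumes "\<And>n. Z n \<in> M \<rightarrow>\<^sub>M Lp_borel p" and "j \<le> n"
  shows "Z j \<in> history M p Z n \<rightarrow>\<^sub>M Lp_borel p"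
proof (rule measurableI)
  fix A :: "'d mfun set" assume "A \<in> sets (Lp_borel p)"
  with \<open>j \<le> n\<close> show "Z j -` A \<inter> space (history M p Z n) \<in> sets (history M p Z n)"
    unfolding space_history unfolding history_def sets_measure_of[OF history_generators]
    by (intro sigma_sets.Basic) auto
qed (use measurable_space[OF assms(1)] in auto)

text \<open>Measurability of the class Z n says nothing directly about one section. The averages of
  arctan factor through the class, hence are measurable for the history;
  \<open>AE_section_measurable\<close> passes this to the sections of the arctan, and tan undoes the
  truncation.\<close>

lemma representative_section_adapted:
  assumes M: "prob_space M" and p: "1 \<le> p"
    and Z: "\<And>n. Z n \<in> M \<rightarrow>\<^sub>M Lp_borel p" and z: "representative M z (Z n)"
  shows "AE t in unit_leb. \<exists>v\<in>borel_measurable (history M p Z n). AE \<omega> in M. z \<omega> t $ i = v \<omega>"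
proof -
  have joint [measurable]: "(\<lambda>(\<omega>, t). z \<omega> t) \<in> borel_measurable (M \<Otimes>\<^sub>M unit_leb)"
    and abs: "\<And>\<omega>. \<omega> \<in> space M \<Longrightarrow> abs_mfun (z \<omega>) = Z n \<omega>"
    using z by (auto simp: representative_def)
  have sec: "z \<omega> \<in> borel_measurable unit_leb" if "\<omega> \<in> space M" for \<omega>
    using measurable_Pair2[OF joint that] by simp
  have "AE t in unit_leb. \<exists>v\<in>borel_measurable (history M p Z n). AE \<omega> in M. arctan (z \<omega> t $ i) = v \<omega>"
  proof (rule AE_section_measurable[OF M])
    show "(\<lambda>(\<omega>, t). arctan (z \<omega> t $ i)) \<in> borel_measurable (M \<Otimes>\<^sub>M unit_leb)"
      using joint unfolding split_beta by measurable
    show "\<bar>arctan (z \<omega> t $ i)\<bar> \<le> pi / 2" for \<omega> t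
      using arctan_bounded[of "z \<omega> t $ i"] by linarith
    show "(\<lambda>\<omega>. \<integral>t. indicat_real {a..b} t * arctan (z \<omega> t $ i) \<partial>unit_leb) \<in> borel_measurable (history M p Z n)" for a b
    proof (rule measurable_cong[THEN iffD1])
      show "(\<lambda>\<omega>. arctan_average a b i (Z n \<omega>)) \<in> borel_measurable (history M p Z n)"
        by (rule measurable_compose[OF measurable_history[OF Z order_refl] arctan_average_measurable[OF p]])
    qed (simp add: abs[symmetric] arctan_average_abs_mfun sec)
  qed simp
  then show ?thesis
  proof (rule AE_mp, intro AE_I2 impI, elim bexE)
    fix t v assume [measurable]: "v \<in> borel_measurable (history M p Z n)"
      and eq: "AE \<omega> in M. arctan (z \<omega> t $ i) = v \<omega>"
    have "(\<lambda>\<omega>. tan (v \<omega>)) \<in> borel_measurable (history M p Z n)"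
      by (simp add: tan_def)
    moreover have "AE \<omega> in M. z \<omega> t $ i = tan (v \<omega>)"
      using eq by (rule AE_mp) (rule AE_I2, metis tan_arctan)
    ultimately show "\<exists>v\<in>borel_measurable (history M p Z n). AE \<omega> in M. z \<omega> t $ i = v \<omega>"
      by (intro bexI[of _ "\<lambda>\<omega>. tan (v \<omega>)"])
  qed
qed

section \<open>Doob's inequality and square summable martingale increments\<close>

primrec running_max :: "(nat \<Rightarrow> real) \<Rightarrow> nat \<Rightarrow> real" where
  "running_max x 0 = 0"
| "running_max x (Suc n) = max (running_max x n) \<bar>\<Sum>k<Suc n. x k\<bar>"

lemma running_max_nonneg: "0 \<le> running_max x n"
  by (induction n) auto

lemma abs_walk_le_running_max: "\<bar>\<Sum>k<n. x k\<bar> \<le> running_max x n"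
  by (cases n) auto

lemma running_max_mono: "m \<le> n \<Longrightarrow> running_max x m \<le> running_max x n"
  by (rule lift_Suc_mono_le) auto

lemma running_max_le: "running_max x n \<le> (\<Sum>k<n. \<bar>x k\<bar>)"
proof (induction n)
  case (Suc n)
  have "\<bar>\<Sum>k<Suc n. x k\<bar> \<le> (\<Sum>k<Suc n. \<bar>x k\<bar>)" by (rule sum_abs)
  with Suc show ?case by simp
qed simp

lemma borel_measurable_running_max [measurable (raw)]:
  assumes "\<And>k. k < n \<Longrightarrow> (\<lambda>\<omega>. x k \<omega>) \<in> borel_measurable M"
  shows "(\<lambda>\<omega>. running_max (\<lambda>k. x k \<omega>) n) \<in> borel_measurable M"
  using assms
proof (induction n)
  case (Suc n)
  then have "(\<lambda>\<omega>. \<Sum>k<Suc n. x k \<omega>) \<in> borel_measurable M" by (intro borel_measurable_sum) auto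
  with Suc show ?case by simp
qed simp

text \<open>The pathwise form of Doob's \<open>L\<^sup>2\<close> inequality: for a martingale difference sequence \<open>x\<close>
  the second sum has expectation zero.\<close>

lemma pathwise_doob:
  "(running_max x n)\<^sup>2 \<le> 4 * (\<Sum>k<n. (x k)\<^sup>2)
     + (\<Sum>k<n. (8 * (\<Sum>j<k. x j) - 4 * running_max x k * sgn (\<Sum>j<k. x j)) * x k)"
proof -
  define s where "s k = (\<Sum>j<k. x j)" for k
  define R where "R = running_max x"
  have s_Suc: "s (Suc k) = s k + x k" for k by (simp add: s_def)
  have R_Suc: "R (Suc k) = max (R k) \<bar>s (Suc k)\<bar>" for k by (simp add: R_def s_def)
  have R0: "0 \<le> R k" for k by (simp add: R_def running_max_nonneg)
  have sq: "(s n)\<^sup>2 = (\<Sum>k<n. (x k)\<^sup>2) + (\<Sum>k<n. 2 * s k * x k)"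
    by (induction n) (simp_all add: s_Suc power2_sum, simp add: s_def)
  \<comment> \<open>The left side is a potential. A step of s at fixed R changes it by at most the
    next summand, since sgn s is a slope of the convex absolute value; raising R to a new maximum
    |s| lowers it by 2 (R - |s|)^2.\<close>
  have "2 * (R n)\<^sup>2 - 4 * R n * \<bar>s n\<bar> \<le> - (\<Sum>k<n. 4 * R k * sgn (s k) * x k)"
  proof (induction n)
    case (Suc n)
    have "sgn (s n) * x n \<le> \<bar>s (Suc n)\<bar> - \<bar>s n\<bar>" by (auto simp: s_Suc sgn_if)
    then have "4 * R n * (sgn (s n) * x n) \<le> 4 * R n * (\<bar>s (Suc n)\<bar> - \<bar>s n\<bar>)"
      using R0 by (intro mult_left_mono) auto
    moreover have "2 * (R (Suc n))\<^sup>2 - 4 * R (Suc n) * \<bar>s (Suc n)\<bar> \<le> 2 * (R n)\<^sup>2 - 4 * R n * \<bar>s (Suc n)\<bar>"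
    proof (cases "\<bar>s (Suc n)\<bar> \<le> R n")
      case False
      have "0 \<le> 2 * (R n - \<bar>s (Suc n)\<bar>)\<^sup>2" by simp
      also have "\<dots> = 2 * (R n)\<^sup>2 - 4 * R n * \<bar>s (Suc n)\<bar> + 2 * \<bar>s (Suc n)\<bar>\<^sup>2"
        by (simp add: power2_diff algebra_simps)
      finally show ?thesis using False by (simp add: R_Suc max_def power2_eq_square)
    qed (simp add: R_Suc max_def)
    ultimately show ?case using Suc by (simp add: algebra_simps)
  qed (simp add: R_def)
  \<comment> \<open>The origin of Doob's constant 4: the two sides differ by the square of R - 2
    |s|.\<close>
  moreover have "(R n)\<^sup>2 \<le> 4 * (s n)\<^sup>2 + (2 * (R n)\<^sup>2 - 4 * R n * \<bar>s n\<bar>)"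
  proof -
    have "0 \<le> (R n - 2 * \<bar>s n\<bar>)\<^sup>2" by simp
    then show ?thesis by (simp add: power2_diff algebra_simps)
  qed
  ultimately have "(R n)\<^sup>2 \<le> 4 * (s n)\<^sup>2 - (\<Sum>k<n. 4 * R k * sgn (s k) * x k)" by linarith
  also have "\<dots> = 4 * (\<Sum>k<n. (x k)\<^sup>2) + (\<Sum>k<n. (8 * s k - 4 * R k * sgn (s k)) * x k)"
    unfolding sq by (simp add: sum_distrib_left sum_subtractf[symmetric] algebra_simps sum.distrib[symmetric])
  finally show ?thesis by (simp add: R_def s_def)
qed

text \<open>The expectation of \<open>pathwise_doob\<close>: the factor H k of the k-th increment is
  bounded and known at time k, so \<open>centred\<close> removes the second sum.\<close>

lemma doob_L2_bounded:
  fixes x :: "nat \<Rightarrow> 'w \<Rightarrow> real"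
  assumes M: "prob_space M"
    and F: "\<And>n. subalgebra M (F n)" "\<And>m n. m \<le> n \<Longrightarrow> sets (F m) \<subseteq> sets (F n)"
    and [measurable]: "\<And>k. x k \<in> borel_measurable M"
    and adapted: "\<And>k. \<exists>v\<in>borel_measurable (F (Suc k)). AE \<omega> in M. x k \<omega> = v \<omega>"
    and bounded: "\<And>k. AE \<omega> in M. \<bar>x k \<omega>\<bar> \<le> b k"
    and centred: "\<And>k h c. h \<in> borel_measurable (F k) \<Longrightarrow> (\<And>\<omega>. \<bar>h \<omega>\<bar> \<le> c) \<Longrightarrow> (\<integral>\<omega>. h \<omega> * x k \<omega> \<partial>M) = 0"
  shows "(\<integral>\<^sup>+\<omega>. ennreal ((running_max (\<lambda>k. x k \<omega>) n)\<^sup>2) \<partial>M) \<le> 4 * (\<Sum>k<n. \<integral>\<^sup>+\<omega>. ennreal ((x k \<omega>)\<^sup>2) \<partial>M)"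
proof -
  interpret prob_space M by (rule M)
  obtain v where v: "\<And>k. v k \<in> borel_measurable (F (Suc k))" "\<And>k. AE \<omega> in M. x k \<omega> = v k \<omega>"
    using adapted by metis
  define B where "B k = \<bar>b k\<bar>" for k
  \<comment> \<open>x is adapted and bounded only up to null sets. Its version v, clamped to the
    interval from -B to B, is so everywhere, as \<open>centred\<close> demands of the functions
    built from it.\<close>
  define y where "y k \<omega> = max (- B k) (min (B k) (v k \<omega>))" for k \<omega>
  have y_F: "y k \<in> borel_measurable (F n)" if "Suc k \<le> n" for k n
  proof -
    have "y k \<in> borel_measurable (F (Suc k))" using v(1)[of k] unfolding y_def by measurable
    moreover have "space (F (Suc k)) = space (F n)" using F(1) by (metis subalgebra_def)
    ultimately show ?thesis using F(2)[OF that] by (auto simp: measurable_def)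
  qed
  have y_meas [measurable]: "y k \<in> borel_measurable M" for k
    using y_F[of k "Suc k"] F(1)[of "Suc k"] by (simp add: measurable_from_subalg)
  have y_bound: "\<bar>y k \<omega>\<bar> \<le> B k" for k \<omega> by (simp add: y_def B_def)
  have xy: "AE \<omega> in M. x k \<omega> = y k \<omega>" for k
    using v(2)[of k] bounded[of k] by eventually_elim (auto simp: y_def B_def)
  define H where "H k \<omega> = 8 * (\<Sum>j<k. y j \<omega>) - 4 * running_max (\<lambda>k. y k \<omega>) k * sgn (\<Sum>j<k. y j \<omega>)" for k \<omega>
  have H_F: "H k \<in> borel_measurable (F k)" for k
  proof -
    have [measurable]: "y j \<in> borel_measurable (F k)" if "j < k" for j using y_F that by simp
    then have [measurable]: "(\<lambda>\<omega>. \<Sum>j<k. y j \<omega>) \<in> borel_measurable (F k)"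
      and [measurable]: "(\<lambda>\<omega>. running_max (\<lambda>k. y k \<omega>) k) \<in> borel_measurable (F k)"
      by (auto intro!: borel_measurable_sum borel_measurable_running_max)
    show ?thesis unfolding H_def by measurable
  qed
  have H_meas [measurable]: "H k \<in> borel_measurable M" for k
    using H_F[of k] F(1)[of k] by (simp add: measurable_from_subalg)
  \<comment> \<open>12 = 8 + 4: the walk and its running maximum are both at most the sum of the B
    j.\<close>
  have H_bound: "\<bar>H k \<omega>\<bar> \<le> 12 * (\<Sum>j<k. B j)" for k \<omega>
  proof -
    have "running_max (\<lambda>k. y k \<omega>) k \<le> (\<Sum>j<k. B j)"
      by (rule order_trans[OF running_max_le sum_mono]) (rule y_bound)
    moreover have "\<bar>\<Sum>j<k. y j \<omega>\<bar> \<le> running_max (\<lambda>k. y k \<omega>) k" by (rule abs_walk_le_running_max)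
    moreover have "\<bar>running_max (\<lambda>k. y k \<omega>) k * sgn (\<Sum>j<k. y j \<omega>)\<bar> \<le> running_max (\<lambda>k. y k \<omega>) k"
      using running_max_nonneg[of "\<lambda>k. y k \<omega>" k] by (auto simp: abs_mult sgn_if)
    ultimately show ?thesis unfolding H_def by linarith
  qed
  have H_zero: "(\<integral>\<omega>. H k \<omega> * y k \<omega> \<partial>M) = 0" for k
  proof -
    have "(\<integral>\<omega>. H k \<omega> * y k \<omega> \<partial>M) = (\<integral>\<omega>. H k \<omega> * x k \<omega> \<partial>M)"
      using xy[of k] by (intro integral_cong_AE) auto
    with centred[OF H_F H_bound] show ?thesis by simp
  qed
  have int_Hy: "integrable M (\<lambda>\<omega>. H k \<omega> * y k \<omega>)" for k
    by (rule integrable_const_bound[of _ "12 * (\<Sum>j<k. B j) * B k"])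
      (auto simp: abs_mult intro!: mult_mono H_bound y_bound order_trans[OF abs_ge_zero H_bound])
  have "(y k \<omega>)\<^sup>2 \<le> (B k)\<^sup>2" for k \<omega>
    using power_mono[OF y_bound abs_ge_zero, of k \<omega> 2] by simp
  then have int_y2: "integrable M (\<lambda>\<omega>. (y k \<omega>)\<^sup>2)" for k
    by (intro integrable_const_bound[of _ "(B k)\<^sup>2"]) auto
  have "(\<integral>\<^sup>+\<omega>. ennreal ((running_max (\<lambda>k. x k \<omega>) n)\<^sup>2) \<partial>M) = (\<integral>\<^sup>+\<omega>. ennreal ((running_max (\<lambda>k. y k \<omega>) n)\<^sup>2) \<partial>M)"
  proof (rule nn_integral_cong_AE)
    have "AE \<omega> in M. \<forall>k. x k \<omega> = y k \<omega>" using xy by (simp add: AE_all_countable)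
    then show "AE \<omega> in M. ennreal ((running_max (\<lambda>k. x k \<omega>) n)\<^sup>2) = ennreal ((running_max (\<lambda>k. y k \<omega>) n)\<^sup>2)"
      by eventually_elim simp
  qed
  also have "\<dots> \<le> (\<integral>\<^sup>+\<omega>. ennreal (4 * (\<Sum>k<n. (y k \<omega>)\<^sup>2) + (\<Sum>k<n. H k \<omega> * y k \<omega>)) \<partial>M)"
    by (intro nn_integral_mono ennreal_leI) (unfold H_def, rule pathwise_doob)
  also have "\<dots> = ennreal (\<integral>\<omega>. 4 * (\<Sum>k<n. (y k \<omega>)\<^sup>2) + (\<Sum>k<n. H k \<omega> * y k \<omega>) \<partial>M)"
    using int_Hy int_y2
    by (intro nn_integral_eq_integral AE_I2 order_trans[OF zero_le_power2 pathwise_doob[of "\<lambda>k. y k _", folded H_def]])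
      auto
  also have "(\<integral>\<omega>. 4 * (\<Sum>k<n. (y k \<omega>)\<^sup>2) + (\<Sum>k<n. H k \<omega> * y k \<omega>) \<partial>M) = 4 * (\<Sum>k<n. \<integral>\<omega>. (y k \<omega>)\<^sup>2 \<partial>M)"
    using int_Hy int_y2 by (simp add: H_zero)
  also have "ennreal \<dots> = 4 * (\<Sum>k<n. \<integral>\<^sup>+\<omega>. ennreal ((y k \<omega>)\<^sup>2) \<partial>M)"
    using int_y2 by (simp add: ennreal_mult' nn_integral_eq_integral flip: sum_ennreal)
  also have "(\<Sum>k<n. \<integral>\<^sup>+\<omega>. ennreal ((y k \<omega>)\<^sup>2) \<partial>M) = (\<Sum>k<n. \<integral>\<^sup>+\<omega>. ennreal ((x k \<omega>)\<^sup>2) \<partial>M)"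
  proof (intro sum.cong refl nn_integral_cong_AE)
    show "AE \<omega> in M. ennreal ((y k \<omega>)\<^sup>2) = ennreal ((x k \<omega>)\<^sup>2)" for k
      using xy[of k] by eventually_elim simp
  qed
  finally show ?thesis .
qed

section \<open>Martingale increments with values in L^2 of a second measure space\<close>

lemma power2_norm_vec: "(norm (x :: real ^ 'd::finite))\<^sup>2 = (\<Sum>i\<in>UNIV. (x $ i)\<^sup>2)"
  by (simp add: norm_vec_def L2_set_def sum_nonneg)

text \<open>Doob's inequality for each coordinate at almost every t, integrated over t by Tonelli,
  bounds the expected maximal energy after time m by 4 times the tail of s, uniformly in n.\<close>

lemma martingale_increments_tail:
  fixes d :: "nat \<Rightarrow> 'w \<Rightarrow> 't \<Rightarrow> real ^ 'd::finite"
  assumes M: "prob_space M" and T: "sigma_finite_measure T"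
    and F: "\<And>n. subalgebra M (F n)" "\<And>m n. m \<le> n \<Longrightarrow> sets (F m) \<subseteq> sets (F n)"
    and d: "\<And>k. (\<lambda>(\<omega>, t). d k \<omega> t) \<in> borel_measurable (M \<Otimes>\<^sub>M T)"
    and adapted: "\<And>k i. AE t in T. \<exists>v\<in>borel_measurable (F (Suc k)). AE \<omega> in M. d k \<omega> t $ i = v \<omega>"
    and bounded: "\<And>k i. AE t in T. AE \<omega> in M. \<bar>d k \<omega> t $ i\<bar> \<le> b k"
    and centred: "\<And>k i. AE t in T. \<forall>h\<in>borel_measurable (F k). \<forall>c. (\<forall>\<omega>. \<bar>h \<omega>\<bar> \<le> c) \<longrightarrow> (\<integral>\<omega>. h \<omega> * d k \<omega> t $ i \<partial>M) = 0"
    and square: "\<And>k. (\<integral>\<^sup>+\<omega>. \<integral>\<^sup>+t. ennreal ((norm (d k \<omega> t))\<^sup>2) \<partial>T \<partial>M) \<le> ennreal (s k)"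
    and s: "\<And>k. 0 \<le> s k" "summable s"
  shows "AE \<omega> in M. \<forall>\<epsilon>>0. \<exists>m. \<forall>n. (\<integral>\<^sup>+t. ennreal ((norm (\<Sum>k<n. d (m + k) \<omega> t))\<^sup>2) \<partial>T) < \<epsilon>"
proof -
  interpret M: prob_space M by (rule M)
  interpret T: sigma_finite_measure T by (rule T)
  interpret pair_sigma_finite M T ..
  have d_meas [measurable]: "(\<lambda>x. d k (fst x) (snd x) $ i) \<in> borel_measurable (M \<Otimes>\<^sub>M T)" for k i
    using d[of k] by (simp add: split_beta)
  have d_norm [measurable]: "(\<lambda>x. norm (d k (fst x) (snd x))) \<in> borel_measurable (M \<Otimes>\<^sub>M T)" for k
    using d[of k] by (simp add: split_beta)
  \<comment> \<open>The maximum is taken at each t before integrating. The result dominates the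
    squared norm of the sum and, unlike it, increases with n, so monotone convergence handles the
    supremum over n.\<close>
  define q where "q m n \<omega> t = (\<Sum>i\<in>UNIV. (running_max (\<lambda>k. d (m + k) \<omega> t $ i) n)\<^sup>2)" for m n \<omega> t
  have q_meas [measurable]: "(\<lambda>x. ennreal (q m n (fst x) (snd x))) \<in> borel_measurable (M \<Otimes>\<^sub>M T)" for m n
    unfolding q_def by measurable
  have q_mono: "q m n \<omega> t \<le> q m n' \<omega> t" if "n \<le> n'" for m n n' \<omega> t
    unfolding q_def using that
    by (intro sum_mono power_mono running_max_mono running_max_nonneg)
  define E where "E m n \<omega> = (\<integral>\<^sup>+t. ennreal (q m n \<omega> t) \<partial>T)" for m n \<omega>
  have E_meas [measurable]: "E m n \<in> borel_measurable M" for m n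
    unfolding E_def using q_meas[of m n] T.borel_measurable_nn_integral_fst[of "\<lambda>x. ennreal (q m n (fst x) (snd x))" M] by simp
  \<comment> \<open>One null set of t serves all of the countably many pairs k, i.\<close>
  have all: "AE t in T. \<forall>k i. (\<exists>v\<in>borel_measurable (F (Suc k)). AE \<omega> in M. d k \<omega> t $ i = v \<omega>) \<and>
      (AE \<omega> in M. \<bar>d k \<omega> t $ i\<bar> \<le> b k) \<and>
      (\<forall>h\<in>borel_measurable (F k). \<forall>c. (\<forall>\<omega>. \<bar>h \<omega>\<bar> \<le> c) \<longrightarrow> (\<integral>\<omega>. h \<omega> * d k \<omega> t $ i \<partial>M) = 0)"
    using adapted bounded centred by (simp add: AE_all_countable)
  have sec [measurable]: "(\<lambda>\<omega>. d k \<omega> t $ i) \<in> borel_measurable M" if "t \<in> space T" for k i t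
    using measurable_Pair1[OF d_meas that] by simp
  have doob: "AE t in T. (\<integral>\<^sup>+\<omega>. ennreal (q m n \<omega> t) \<partial>M) \<le> 4 * (\<Sum>k<n. \<integral>\<^sup>+\<omega>. ennreal ((norm (d (m + k) \<omega> t))\<^sup>2) \<partial>M)" for m n
    using all AE_space
  proof eventually_elim
    fix t assume t: "t \<in> space T"
      and *: "\<forall>k i. (\<exists>v\<in>borel_measurable (F (Suc k)). AE \<omega> in M. d k \<omega> t $ i = v \<omega>) \<and>
      (AE \<omega> in M. \<bar>d k \<omega> t $ i\<bar> \<le> b k) \<and>
      (\<forall>h\<in>borel_measurable (F k). \<forall>c. (\<forall>\<omega>. \<bar>h \<omega>\<bar> \<le> c) \<longrightarrow> (\<integral>\<omega>. h \<omega> * d k \<omega> t $ i \<partial>M) = 0)"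
    note [measurable] = sec[OF t]
    have "(\<integral>\<^sup>+\<omega>. ennreal (q m n \<omega> t) \<partial>M) = (\<Sum>i\<in>UNIV. \<integral>\<^sup>+\<omega>. ennreal ((running_max (\<lambda>k. d (m + k) \<omega> t $ i) n)\<^sup>2) \<partial>M)"
      unfolding q_def by (simp add: nn_integral_sum flip: sum_ennreal)
    also have "\<dots> \<le> (\<Sum>i\<in>UNIV. 4 * (\<Sum>k<n. \<integral>\<^sup>+\<omega>. ennreal ((d (m + k) \<omega> t $ i)\<^sup>2) \<partial>M))"
    proof (rule sum_mono, rule doob_L2_bounded[OF M, where F = "\<lambda>k. F (m + k)"])
      show "sets (F (m + k)) \<subseteq> sets (F (m + k'))" if "k \<le> k'" for k k' using that F(2) by simp
      show "\<exists>v\<in>borel_measurable (F (m + Suc k)). AE \<omega> in M. d (m + k) \<omega> t $ i = v \<omega>" for i k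
        using * by simp
      show "AE \<omega> in M. \<bar>d (m + k) \<omega> t $ i\<bar> \<le> b (m + k)" for i k using * by blast
      show "(\<integral>\<omega>. h \<omega> * d (m + k) \<omega> t $ i \<partial>M) = 0"
        if "h \<in> borel_measurable (F (m + k))" "\<And>\<omega>. \<bar>h \<omega>\<bar> \<le> c" for i k h c using * that by blast
    qed (use F(1) sec[OF t] in auto)
    also have "\<dots> = 4 * (\<Sum>k<n. \<Sum>i\<in>UNIV. \<integral>\<^sup>+\<omega>. ennreal ((d (m + k) \<omega> t $ i)\<^sup>2) \<partial>M)"
      by (subst sum.swap) (simp add: sum_distrib_left)
    also have "(\<lambda>k. \<Sum>i\<in>UNIV. \<integral>\<^sup>+\<omega>. ennreal ((d (m + k) \<omega> t $ i)\<^sup>2) \<partial>M) = (\<lambda>k. \<integral>\<^sup>+\<omega>. ennreal ((norm (d (m + k) \<omega> t))\<^sup>2) \<partial>M)"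
      unfolding power2_norm_vec by (simp add: nn_integral_sum flip: sum_ennreal)
    finally show "(\<integral>\<^sup>+\<omega>. ennreal (q m n \<omega> t) \<partial>M) \<le> 4 * (\<Sum>k<n. \<integral>\<^sup>+\<omega>. ennreal ((norm (d (m + k) \<omega> t))\<^sup>2) \<partial>M)" .
  qed
  have E_le: "(\<integral>\<^sup>+\<omega>. E m n \<omega> \<partial>M) \<le> ennreal (4 * (\<Sum>k. s (k + m)))" for m n
  proof -
    have "(\<integral>\<^sup>+\<omega>. E m n \<omega> \<partial>M) = (\<integral>\<^sup>+t. \<integral>\<^sup>+\<omega>. ennreal (q m n \<omega> t) \<partial>M \<partial>T)"
      unfolding E_def using Fubini'[of "\<lambda>x y. ennreal (q m n x y)"] q_meas[of m n] by (simp add: split_beta)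
    also have "\<dots> \<le> (\<integral>\<^sup>+t. 4 * (\<Sum>k<n. \<integral>\<^sup>+\<omega>. ennreal ((norm (d (m + k) \<omega> t))\<^sup>2) \<partial>M) \<partial>T)"
      by (rule nn_integral_mono_AE[OF doob])
    also have "\<dots> = 4 * (\<Sum>k<n. \<integral>\<^sup>+t. \<integral>\<^sup>+\<omega>. ennreal ((norm (d (m + k) \<omega> t))\<^sup>2) \<partial>M \<partial>T)"
    proof -
      have [measurable]: "(\<lambda>t. \<integral>\<^sup>+\<omega>. ennreal ((norm (d k \<omega> t))\<^sup>2) \<partial>M) \<in> borel_measurable T" for k
      proof (rule M.borel_measurable_nn_integral)
        have "(\<lambda>x. norm (d k (snd x) (fst x))) \<in> borel_measurable (T \<Otimes>\<^sub>M M)"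
          using measurable_compose[OF measurable_pair_swap' d_norm] by (simp add: split_beta)
        then show "(\<lambda>(t, \<omega>). ennreal ((norm (d k \<omega> t))\<^sup>2)) \<in> borel_measurable (T \<Otimes>\<^sub>M M)"
          unfolding split_beta by measurable
      qed
      show ?thesis by (simp add: nn_integral_cmult nn_integral_sum)
    qed
    also have "\<dots> = 4 * (\<Sum>k<n. \<integral>\<^sup>+\<omega>. \<integral>\<^sup>+t. ennreal ((norm (d (m + k) \<omega> t))\<^sup>2) \<partial>T \<partial>M)"
      by (subst Fubini') (auto simp: split_beta)
    also have "\<dots> \<le> 4 * (\<Sum>k<n. ennreal (s (m + k)))"
      by (intro mult_left_mono sum_mono square) simp
    also have "\<dots> = ennreal (4 * (\<Sum>k<n. s (k + m)))"
      using s(1) by (simp add: sum_ennreal ennreal_mult' add.commute)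
    also have "\<dots> \<le> ennreal (4 * (\<Sum>k. s (k + m)))"
      using s by (intro ennreal_leI mult_left_mono sum_le_suminf) (auto simp: summable_iff_shift)
    finally show ?thesis .
  qed
  \<comment> \<open>Its expectation is at most each of the tail bounds, which vanish as m grows. A
    zero infimum supplies one starting time m for each \<epsilon>.\<close>
  have "AE \<omega> in M. (INF m. SUP n. E m n \<omega>) = 0"
  proof -
    have "(\<integral>\<^sup>+\<omega>. (INF m. SUP n. E m n \<omega>) \<partial>M) \<le> ennreal (4 * (\<Sum>k. s (k + m)))" for m
    proof -
      have "(\<integral>\<^sup>+\<omega>. (INF m. SUP n. E m n \<omega>) \<partial>M) \<le> (\<integral>\<^sup>+\<omega>. (SUP n. E m n \<omega>) \<partial>M)"
        by (intro nn_integral_mono INF_lower) simp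
      also have "\<dots> = (SUP n. \<integral>\<^sup>+\<omega>. E m n \<omega> \<partial>M)"
        by (rule nn_integral_monotone_convergence_SUP)
          (auto simp: incseq_def le_fun_def E_def intro!: nn_integral_mono ennreal_leI q_mono)
      also have "\<dots> \<le> ennreal (4 * (\<Sum>k. s (k + m)))" by (rule SUP_least) (rule E_le)
      finally show ?thesis .
    qed
    moreover have "(\<lambda>m. ennreal (4 * (\<Sum>k. s (k + m)))) \<longlonglongrightarrow> 0"
    proof -
      have "(\<lambda>m. 4 * (\<Sum>k. s (k + m))) \<longlonglongrightarrow> 4 * 0"
        by (intro tendsto_mult_left suminf_exist_split2 s)
      then show ?thesis using tendsto_ennrealI by fastforce
    qed
    ultimately have "(\<integral>\<^sup>+\<omega>. (INF m. SUP n. E m n \<omega>) \<partial>M) \<le> 0"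
      by (intro LIMSEQ_le_const) auto
    then show ?thesis by (subst (asm) le_zero_eq, subst (asm) nn_integral_0_iff_AE) auto
  qed
  then show ?thesis
  proof eventually_elim
    fix \<omega> assume inf: "(INF m. SUP n. E m n \<omega>) = 0"
    show "\<forall>\<epsilon>>0. \<exists>m. \<forall>n. (\<integral>\<^sup>+t. ennreal ((norm (\<Sum>k<n. d (m + k) \<omega> t))\<^sup>2) \<partial>T) < \<epsilon>"
    proof (intro allI impI)
      fix \<epsilon> :: ennreal assume "0 < \<epsilon>"
      then have "(INF m. SUP n. E m n \<omega>) < \<epsilon>" by (simp add: inf)
      then obtain m where m: "(SUP n. E m n \<omega>) < \<epsilon>" by (auto simp: INF_less_iff)
      have "(\<integral>\<^sup>+t. ennreal ((norm (\<Sum>k<n. d (m + k) \<omega> t))\<^sup>2) \<partial>T) \<le> E m n \<omega>" for n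
        unfolding E_def
      proof (intro nn_integral_mono ennreal_leI)
        fix t
        have "(\<Sum>k<n. d (m + k) \<omega> t $ i)\<^sup>2 \<le> (running_max (\<lambda>k. d (m + k) \<omega> t $ i) n)\<^sup>2" for i
          using power_mono[OF abs_walk_le_running_max abs_ge_zero, of "\<lambda>k. d (m + k) \<omega> t $ i" n 2] by simp
        then show "(norm (\<Sum>k<n. d (m + k) \<omega> t))\<^sup>2 \<le> q m n \<omega> t"
          by (simp add: power2_norm_vec q_def sum_mono)
      qed
      also have "E m n \<omega> \<le> (SUP n. E m n \<omega>)" for n by (rule SUP_upper) simp
      finally show "\<exists>m. \<forall>n. (\<integral>\<^sup>+t. ennreal ((norm (\<Sum>k<n. d (m + k) \<omega> t))\<^sup>2) \<partial>T) < \<epsilon>"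
        using m by (meson le_less_trans)
    qed
  qed
qed

section \<open>The noise and its truncation\<close>

text \<open>By Tonelli the series of nonnegative terms has finite expectation, so it is finite
  almost surely.\<close>

lemma AE_summable_of_expectation_le:
  assumes X: "\<And>k. expectation_le M (X k) (c k)" and nonneg: "\<And>k \<omega>. 0 \<le> X k \<omega>"
    and a: "\<And>k. 0 \<le> a k" and sum: "summable (\<lambda>k. a k * c k)"
  shows "AE \<omega> in M. summable (\<lambda>k. a k * X k \<omega>)"
proof -
  have int: "integrable M (X k)" and le: "(\<integral>\<omega>. X k \<omega> \<partial>M) \<le> c k" for k
    using X by (auto simp: expectation_le_def)
  then have [measurable]: "X k \<in> borel_measurable M" for k by auto
  have c: "0 \<le> c k" for k
    using order_trans[OF integral_nonneg_AE le] nonneg by auto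
  have "(\<integral>\<^sup>+\<omega>. (\<Sum>k. ennreal (a k * X k \<omega>)) \<partial>M) = (\<Sum>k. \<integral>\<^sup>+\<omega>. ennreal (a k * X k \<omega>) \<partial>M)"
    by (rule nn_integral_suminf) simp
  also have "\<dots> = (\<Sum>k. ennreal (a k * (\<integral>\<omega>. X k \<omega> \<partial>M)))"
    using int a nonneg by (subst nn_integral_eq_integral) auto
  also have "\<dots> \<le> (\<Sum>k. ennreal (a k * c k))"
    using le a by (intro suminf_le ennreal_leI mult_left_mono) auto
  also have "\<dots> = ennreal (\<Sum>k. a k * c k)"
    using sum a c by (intro suminf_ennreal2) auto
  finally have "(\<integral>\<^sup>+\<omega>. (\<Sum>k. ennreal (a k * X k \<omega>)) \<partial>M) \<noteq> \<infinity>"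
    by (auto simp: top_unique)
  then have "AE \<omega> in M. (\<Sum>k. ennreal (a k * X k \<omega>)) \<noteq> \<infinity>"
    by (intro nn_integral_PInf_AE) auto
  then show ?thesis
    by eventually_elim (auto intro!: summable_suminf_not_top mult_nonneg_nonneg a nonneg)
qed

text \<open>The truncation looks at the norm of the whole vector, so the versions of the coordinates
  are joined into one adapted vector.\<close>

lemma representative_section_adapted_vec:
  fixes z :: "'w \<Rightarrow> real \<Rightarrow> real ^ 'd::finite"
  assumes "prob_space M" "1 \<le> p" "\<And>n. Z n \<in> M \<rightarrow>\<^sub>M Lp_borel p" "representative M z (Z n)"
  shows "AE t in unit_leb. \<exists>v\<in>borel_measurable (history M p Z n). AE \<omega> in M. z \<omega> t = v \<omega>"
proof -
  have "AE t in unit_leb. \<forall>i. \<exists>v\<in>borel_measurable (history M p Z n). AE \<omega> in M. z \<omega> t $ i = v \<omega>"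
    using representative_section_adapted[where Z = Z and n = n, OF assms] by (simp add: AE_all_countable)
  then show ?thesis
  proof eventually_elim
    fix t assume "\<forall>i. \<exists>v\<in>borel_measurable (history M p Z n). AE \<omega> in M. z \<omega> t $ i = v \<omega>"
    then obtain v where v: "\<And>i. v i \<in> borel_measurable (history M p Z n)" "\<And>i. AE \<omega> in M. z \<omega> t $ i = v i \<omega>"
      by metis
    have "(\<lambda>\<omega>. \<chi> i. v i \<omega>) \<in> borel_measurable (history M p Z n)"
      using v(1) by (subst borel_measurable_euclidean_space) (auto simp: Basis_vec_def inner_axis)
    moreover have "AE \<omega> in M. \<forall>i. z \<omega> t $ i = v i \<omega>" using v(2) by (simp add: AE_all_countable)
    then have "AE \<omega> in M. z \<omega> t = (\<chi> i. v i \<omega>)" by eventually_elim (simp add: vec_eq_iff)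
    ultimately show "\<exists>v\<in>borel_measurable (history M p Z n). AE \<omega> in M. z \<omega> t = v \<omega>"
      by (intro bexI[of _ "\<lambda>\<omega>. \<chi> i. v i \<omega>"])
  qed
qed

text \<open>The noise apart from G and \<lambda>: the multipliers enter the results below only as
  adapted weights c with |c| \<le> 1.\<close>

locale truncated_noise = prob_space M for M :: "'w measure" +
  fixes p :: real and \<alpha> \<sigma>2 :: "nat \<Rightarrow> real" and Z :: "nat \<Rightarrow> 'w \<Rightarrow> ('d::finite) mfun"
    and z zbar :: "nat \<Rightarrow> 'w \<Rightarrow> real \<Rightarrow> real ^ 'd"
  assumes p: "1 \<le> p" "p \<le> 2" and \<alpha>_pos: "\<And>n. 0 < \<alpha> n"
    and Z_measurable: "\<And>n. Z n \<in> M \<rightarrow>\<^sub>M Lp_borel p"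
    and z: "\<And>n. representative M (z n) (Z n)"
    and zbar: "\<And>n. cond_exp_version M (history M p Z n)
      (\<lambda>\<omega> t. indicat_real {s. \<alpha> n * norm (z (Suc n) \<omega> s) < 1} t *\<^sub>R z (Suc n) \<omega> t) (zbar (Suc n))"
    and \<sigma>2: "\<And>n. expectation_le M
      (\<lambda>\<omega>. \<integral>t. (norm (indicat_real {s. norm (\<alpha> n *\<^sub>R z (Suc n) \<omega> s) < 1} t *\<^sub>R z (Suc n) \<omega> t
        - zbar (Suc n) \<omega> t))\<^sup>2 \<partial>unit_leb) (\<sigma>2 n)"
    and \<sigma>2_sum: "summable (\<lambda>n. (\<alpha> n)\<^sup>2 * \<sigma>2 n)"
begin

sublocale unit: prob_space unit_leb by (rule prob_space_unit_leb)
sublocale pair_sigma_finite M unit_leb ..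

text \<open>The index is that of the step size: \<open>small n\<close> cuts the noise of time n + 1
  at level 1/\<alpha>_n.\<close>

definition small :: "nat \<Rightarrow> 'w \<Rightarrow> real \<Rightarrow> real ^ 'd"
  where "small n \<omega> t = (if \<alpha> n * norm (z (Suc n) \<omega> t) < 1 then z (Suc n) \<omega> t else 0)"

lemma small_eq:
  "indicat_real {s. \<alpha> n * norm (z (Suc n) \<omega> s) < 1} t *\<^sub>R z (Suc n) \<omega> t = small n \<omega> t"
  "indicat_real {s. norm (\<alpha> n *\<^sub>R z (Suc n) \<omega> s) < 1} t *\<^sub>R z (Suc n) \<omega> t = small n \<omega> t"
  using \<alpha>_pos[of n] by (auto simp: small_def)

lemma z_measurable [measurable]: "(\<lambda>x. z n (fst x) (snd x)) \<in> borel_measurable (M \<Otimes>\<^sub>M unit_leb)"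
  using z[of n] by (simp add: representative_def case_prod_beta')

lemma zbar_measurable [measurable]: "(\<lambda>x. zbar (Suc n) (fst x) (snd x)) \<in> borel_measurable (M \<Otimes>\<^sub>M unit_leb)"
  using zbar[of n] by (simp add: cond_exp_version_def case_prod_beta')

lemma small_measurable [measurable]: "(\<lambda>x. small n (fst x) (snd x)) \<in> borel_measurable (M \<Otimes>\<^sub>M unit_leb)"
  unfolding small_def by measurable

lemma section_measurable:
  fixes f :: "'w \<Rightarrow> real \<Rightarrow> real ^ 'd"
  assumes "(\<lambda>x. f (fst x) (snd x)) \<in> borel_measurable (M \<Otimes>\<^sub>M unit_leb)"
  shows "\<omega> \<in> space M \<Longrightarrow> f \<omega> \<in> borel_measurable unit_leb"
    and "t \<in> space unit_leb \<Longrightarrow> (\<lambda>\<omega>. f \<omega> t) \<in> borel_measurable M"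
  using measurable_Pair2[OF assms] measurable_Pair1[OF assms] by auto

lemma subalgebra_F: "subalgebra M (history M p Z n)"
  by (rule subalgebra_history[OF Z_measurable])

lemma cond_exp_F: "sigma_finite_subalgebra M (history M p Z n)"
  by (intro finite_measure_subalgebra_is_sigma_finite finite_measure_subalgebra.intro finite_measure_axioms
      finite_measure_subalgebra_axioms.intro subalgebra_F)

lemma norm_small_le: "norm (small n \<omega> t) \<le> 1 / \<alpha> n"
  using \<alpha>_pos[of n] by (auto simp: small_def field_simps)

lemma abs_small_le: "\<bar>small n \<omega> t $ i\<bar> \<le> 1 / \<alpha> n"
  by (rule order_trans[OF component_le_norm_cart norm_small_le])

lemma integrable_small: "t \<in> space unit_leb \<Longrightarrow> integrable M (\<lambda>\<omega>. small n \<omega> t $ i)"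
  by (intro integrable_const_bound[of _ "1 / \<alpha> n"] AE_I2 borel_measurable_vec_nth
      section_measurable(2)[OF small_measurable]) (simp_all add: abs_small_le)

lemma zbar_cond_exp:
  "AE t in unit_leb. t \<in> space unit_leb \<and>
     (\<forall>i. AE \<omega> in M. zbar (Suc n) \<omega> t $ i = real_cond_exp M (history M p Z n) (\<lambda>\<omega>. small n \<omega> t $ i) \<omega>)"
proof -
  have "AE t in unit_leb. \<forall>i. AE \<omega> in M. zbar (Suc n) \<omega> t $ i = real_cond_exp M (history M p Z n) (\<lambda>\<omega>. small n \<omega> t $ i) \<omega>"
    using zbar[of n] by (simp add: cond_exp_version_def small_eq)
  with AE_space show ?thesis by eventually_elim blast
qed

lemma zbar_bounded: "AE t in unit_leb. \<forall>i. AE \<omega> in M. \<bar>zbar (Suc n) \<omega> t $ i\<bar> \<le> 1 / \<alpha> n"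
  using zbar_cond_exp[of n]
proof eventually_elim
  fix t assume *: "t \<in> space unit_leb \<and>
     (\<forall>i. AE \<omega> in M. zbar (Suc n) \<omega> t $ i = real_cond_exp M (history M p Z n) (\<lambda>\<omega>. small n \<omega> t $ i) \<omega>)"
  interpret sigma_finite_subalgebra M "history M p Z n" by (rule cond_exp_F)
  show "\<forall>i. AE \<omega> in M. \<bar>zbar (Suc n) \<omega> t $ i\<bar> \<le> 1 / \<alpha> n"
  proof
    fix i
    have "small n \<omega> t $ i \<le> 1 / \<alpha> n" "- (1 / \<alpha> n) \<le> small n \<omega> t $ i" for \<omega>
      using abs_small_le[of n \<omega> t i] by auto
    then have "AE \<omega> in M. real_cond_exp M (history M p Z n) (\<lambda>\<omega>. small n \<omega> t $ i) \<omega> \<le> 1 / \<alpha> n"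
      "AE \<omega> in M. - (1 / \<alpha> n) \<le> real_cond_exp M (history M p Z n) (\<lambda>\<omega>. small n \<omega> t $ i) \<omega>"
      using * by (auto intro!: real_cond_exp_le_c real_cond_exp_ge_c integrable_small)
    moreover have "AE \<omega> in M. zbar (Suc n) \<omega> t $ i = real_cond_exp M (history M p Z n) (\<lambda>\<omega>. small n \<omega> t $ i) \<omega>"
      using * by blast
    ultimately show "AE \<omega> in M. \<bar>zbar (Suc n) \<omega> t $ i\<bar> \<le> 1 / \<alpha> n"
      by eventually_elim auto
  qed
qed

text \<open>Fubini exchanges the null sets, turning a bound at fixed t into one along almost every
  path.\<close>

lemma zbar_bounded': "AE \<omega> in M. AE t in unit_leb. \<forall>i. \<bar>zbar (Suc n) \<omega> t $ i\<bar> \<le> 1 / \<alpha> n"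
proof -
  have "AE t in unit_leb. AE \<omega> in M. \<forall>i. \<bar>zbar (Suc n) \<omega> t $ i\<bar> \<le> 1 / \<alpha> n"
    using zbar_bounded by (simp add: AE_all_countable)
  then show ?thesis by (subst AE_commute) measurable
qed

text \<open>A bound on the inner integral in the hypothesis on \<mu> does not give integrability in
  t, since a Bochner integral defaults to 0; the boundedness of almost every path does.\<close>

lemma AE_zbar_powr_integrable: "AE \<omega> in M. integrable unit_leb (\<lambda>t. norm (zbar (Suc n) \<omega> t) powr r)" if "0 < r"
  using zbar_bounded'[of n] AE_space
proof eventually_elim
  fix \<omega> assume \<omega>: "\<omega> \<in> space M" and *: "AE t in unit_leb. \<forall>i. \<bar>zbar (Suc n) \<omega> t $ i\<bar> \<le> 1 / \<alpha> n"
  have [measurable]: "zbar (Suc n) \<omega> \<in> borel_measurable unit_leb"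
    by (rule section_measurable(1)[OF zbar_measurable \<omega>])
  show "integrable unit_leb (\<lambda>t. norm (zbar (Suc n) \<omega> t) powr r)"
  proof (rule unit.integrable_const_bound[of _ "(\<Sum>i\<in>(UNIV :: 'd set). 1 / \<alpha> n) powr r"])
    show "AE t in unit_leb. norm (norm (zbar (Suc n) \<omega> t) powr r) \<le> (\<Sum>i\<in>(UNIV :: 'd set). 1 / \<alpha> n) powr r"
      using *
    proof eventually_elim
      fix t assume "\<forall>i. \<bar>zbar (Suc n) \<omega> t $ i\<bar> \<le> 1 / \<alpha> n"
      then have "norm (zbar (Suc n) \<omega> t) \<le> (\<Sum>i\<in>(UNIV :: 'd set). 1 / \<alpha> n)"
        by (intro order_trans[OF norm_le_l1_cart sum_mono]) auto
      then show "norm (norm (zbar (Suc n) \<omega> t) powr r) \<le> (\<Sum>i\<in>(UNIV :: 'd set). 1 / \<alpha> n) powr r"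
        using that by (simp add: powr_mono2)
    qed
  qed measurable
qed

text \<open>The hypothesis on \<open>\<sigma>2\<close> concerns nested Bochner integrals. Almost
  every path is bounded, so the inner one has no default value, and both can be read as the
  nonnegative integrals that Tonelli's theorem handles.\<close>

lemma square_bound:
  "(\<integral>\<^sup>+\<omega>. \<integral>\<^sup>+t. ennreal ((norm (small n \<omega> t - zbar (Suc n) \<omega> t))\<^sup>2) \<partial>unit_leb \<partial>M) \<le> ennreal (\<sigma>2 n)"
proof -
  have "AE \<omega> in M. (\<integral>\<^sup>+t. ennreal ((norm (small n \<omega> t - zbar (Suc n) \<omega> t))\<^sup>2) \<partial>unit_leb)
      = ennreal (\<integral>t. (norm (small n \<omega> t - zbar (Suc n) \<omega> t))\<^sup>2 \<partial>unit_leb)"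
    using AE_zbar_powr_integrable[of 2 n, OF zero_less_numeral] AE_space
  proof eventually_elim
    fix \<omega> assume \<omega>: "\<omega> \<in> space M" and int: "integrable unit_leb (\<lambda>t. norm (zbar (Suc n) \<omega> t) powr 2)"
    have [measurable]: "zbar (Suc n) \<omega> \<in> borel_measurable unit_leb" "small n \<omega> \<in> borel_measurable unit_leb"
      by (rule section_measurable(1)[OF _ \<omega>], measurable)+
    have "integrable unit_leb (\<lambda>t. norm (small n \<omega> t) powr 2)"
      by (rule unit.integrable_const_bound[of _ "(1 / \<alpha> n)\<^sup>2"]) (auto intro!: power_mono norm_small_le)
    moreover have "integrable unit_leb (\<lambda>t. norm (- zbar (Suc n) \<omega> t) powr 2)" using int by simp
    ultimately have "integrable unit_leb (\<lambda>t. norm (small n \<omega> t + - zbar (Suc n) \<omega> t) powr 2)"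
      by (intro Lnorm_triangle(1)) auto
    then show "(\<integral>\<^sup>+t. ennreal ((norm (small n \<omega> t - zbar (Suc n) \<omega> t))\<^sup>2) \<partial>unit_leb)
      = ennreal (\<integral>t. (norm (small n \<omega> t - zbar (Suc n) \<omega> t))\<^sup>2 \<partial>unit_leb)"
      by (intro nn_integral_eq_integral) auto
  qed
  then have "(\<integral>\<^sup>+\<omega>. \<integral>\<^sup>+t. ennreal ((norm (small n \<omega> t - zbar (Suc n) \<omega> t))\<^sup>2) \<partial>unit_leb \<partial>M)
      = (\<integral>\<^sup>+\<omega>. ennreal (\<integral>t. (norm (small n \<omega> t - zbar (Suc n) \<omega> t))\<^sup>2 \<partial>unit_leb) \<partial>M)"
    by (rule nn_integral_cong_AE)
  also have "\<dots> = ennreal (\<integral>\<omega>. \<integral>t. (norm (small n \<omega> t - zbar (Suc n) \<omega> t))\<^sup>2 \<partial>unit_leb \<partial>M)"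
    using \<sigma>2[of n] unfolding expectation_le_def small_eq by (intro nn_integral_eq_integral) auto
  also have "\<dots> \<le> ennreal (\<sigma>2 n)"
    using \<sigma>2[of n] unfolding expectation_le_def small_eq by (intro ennreal_leI) auto
  finally show ?thesis .
qed

lemma \<sigma>2_nonneg: "0 \<le> \<sigma>2 n"
proof -
  have "0 \<le> (\<integral>\<omega>. \<integral>t. (norm (small n \<omega> t - zbar (Suc n) \<omega> t))\<^sup>2 \<partial>unit_leb \<partial>M)"
    by (intro Bochner_Integration.integral_nonneg) simp
  also have "\<dots> \<le> \<sigma>2 n" using \<sigma>2[of n] unfolding expectation_le_def small_eq by simp
  finally show ?thesis .
qed

text \<open>The weight c n is known at time n, so it preserves the centring of the increment, and |c
  n| \<le> 1 preserves the variance bound.\<close>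

lemma martingale_part_tail:
  assumes c: "\<And>n. c n \<in> borel_measurable (history M p Z n)" and c_le: "\<And>n \<omega>. \<bar>c n \<omega>\<bar> \<le> 1"
  defines "d \<equiv> \<lambda>n \<omega> t. (\<alpha> n * c n \<omega>) *\<^sub>R (small n \<omega> t - zbar (Suc n) \<omega> t)"
  shows "AE \<omega> in M. \<forall>\<epsilon>>0. \<exists>m. \<forall>n. (\<integral>\<^sup>+t. ennreal ((norm (\<Sum>k<n. d (m + k) \<omega> t))\<^sup>2) \<partial>unit_leb) < \<epsilon>"
\<comment> \<open>The bound 2: the truncated noise and its conditional mean are each at most
  1/\<alpha>_n, and \<alpha>_n cancels.\<close>
proof (rule martingale_increments_tail[where F = "history M p Z" and b = "\<lambda>_. 2" and s = "\<lambda>n. (\<alpha> n)\<^sup>2 * \<sigma>2 n"])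
  show "prob_space M" by (rule prob_space_axioms)
  show "sigma_finite_measure unit_leb" by (rule unit.sigma_finite_measure_axioms)
  have c_M [measurable]: "c n \<in> borel_measurable M" for n
    using subalgebra_F c by (rule measurable_from_subalg)
  show "(\<lambda>(\<omega>, t). d k \<omega> t) \<in> borel_measurable (M \<Otimes>\<^sub>M unit_leb)" for k
    unfolding d_def split_beta by measurable
  show "AE t in unit_leb. \<exists>v\<in>borel_measurable (history M p Z (Suc k)). AE \<omega> in M. d k \<omega> t $ i = v \<omega>" for k i
    using representative_section_adapted_vec[where Z = Z and n = "Suc k", OF prob_space_axioms p(1) Z_measurable z] zbar_cond_exp[of k]
  proof eventually_elim
    fix t assume "\<exists>v\<in>borel_measurable (history M p Z (Suc k)). AE \<omega> in M. z (Suc k) \<omega> t = v \<omega>"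
      and *: "t \<in> space unit_leb \<and>
       (\<forall>i. AE \<omega> in M. zbar (Suc k) \<omega> t $ i = real_cond_exp M (history M p Z k) (\<lambda>\<omega>. small k \<omega> t $ i) \<omega>)"
    then obtain v where [measurable]: "v \<in> borel_measurable (history M p Z (Suc k))"
      and v: "AE \<omega> in M. z (Suc k) \<omega> t = v \<omega>" by blast
    have up: "f \<in> borel_measurable (history M p Z (Suc k))" if "f \<in> borel_measurable (history M p Z k)" for f :: "'w \<Rightarrow> real"
      using that history_mono[where m = k and n = "Suc k" and M = M and p = p and Z = Z] by (auto simp: measurable_def)
    have [measurable]: "c k \<in> borel_measurable (history M p Z (Suc k))" by (rule up[OF c])
    have [measurable]: "real_cond_exp M (history M p Z k) (\<lambda>\<omega>. small k \<omega> t $ i) \<in> borel_measurable (history M p Z (Suc k))"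
      by (rule up) simp
    \<comment> \<open>The section of \<open>z\<close> is replaced by its version v, known at time k
      + 1, and that of \<open>zbar\<close> by the conditional expectation, known at time k.\<close>
    define w where "w \<omega> = \<alpha> k * c k \<omega> * ((if \<alpha> k * norm (v \<omega>) < 1 then v \<omega> $ i else 0)
        - real_cond_exp M (history M p Z k) (\<lambda>\<omega>. small k \<omega> t $ i) \<omega>)" for \<omega>
    have "w \<in> borel_measurable (history M p Z (Suc k))" unfolding w_def by measurable
    moreover have "AE \<omega> in M. zbar (Suc k) \<omega> t $ i = real_cond_exp M (history M p Z k) (\<lambda>\<omega>. small k \<omega> t $ i) \<omega>"
      using * by blast
    with v have "AE \<omega> in M. d k \<omega> t $ i = w \<omega>"
      by eventually_elim (simp add: d_def w_def small_def)
    ultimately show "\<exists>v\<in>borel_measurable (history M p Z (Suc k)). AE \<omega> in M. d k \<omega> t $ i = v \<omega>" by blast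
  qed
  show "AE t in unit_leb. AE \<omega> in M. \<bar>d k \<omega> t $ i\<bar> \<le> 2" for k i
    using zbar_bounded[of k]
  proof eventually_elim
    fix t assume "\<forall>i. AE \<omega> in M. \<bar>zbar (Suc k) \<omega> t $ i\<bar> \<le> 1 / \<alpha> k"
    then have "AE \<omega> in M. \<bar>zbar (Suc k) \<omega> t $ i\<bar> \<le> 1 / \<alpha> k" by blast
    then show "AE \<omega> in M. \<bar>d k \<omega> t $ i\<bar> \<le> 2"
    proof eventually_elim
      fix \<omega> assume "\<bar>zbar (Suc k) \<omega> t $ i\<bar> \<le> 1 / \<alpha> k"
      with abs_small_le[of k \<omega> t i] have "\<bar>small k \<omega> t $ i - zbar (Suc k) \<omega> t $ i\<bar> \<le> 2 / \<alpha> k" by linarith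
      then have "\<bar>c k \<omega>\<bar> * \<bar>small k \<omega> t $ i - zbar (Suc k) \<omega> t $ i\<bar> \<le> 1 * (2 / \<alpha> k)"
        by (intro mult_mono c_le) auto
      then have "\<alpha> k * (\<bar>c k \<omega>\<bar> * \<bar>small k \<omega> t $ i - zbar (Suc k) \<omega> t $ i\<bar>) \<le> \<alpha> k * (1 * (2 / \<alpha> k))"
        using \<alpha>_pos[of k] by (intro mult_left_mono) auto
      moreover have "\<bar>d k \<omega> t $ i\<bar> = \<alpha> k * (\<bar>c k \<omega>\<bar> * \<bar>small k \<omega> t $ i - zbar (Suc k) \<omega> t $ i\<bar>)"
        using \<alpha>_pos[of k] by (simp add: d_def abs_mult)
      ultimately show "\<bar>d k \<omega> t $ i\<bar> \<le> 2" using \<alpha>_pos[of k] by simp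
    qed
  qed
  show "AE t in unit_leb. \<forall>h\<in>borel_measurable (history M p Z k). \<forall>b. (\<forall>\<omega>. \<bar>h \<omega>\<bar> \<le> b) \<longrightarrow>
      (\<integral>\<omega>. h \<omega> * d k \<omega> t $ i \<partial>M) = 0" for k i
    using zbar_cond_exp[of k]
  proof eventually_elim
    fix t assume *: "t \<in> space unit_leb \<and>
       (\<forall>i. AE \<omega> in M. zbar (Suc k) \<omega> t $ i = real_cond_exp M (history M p Z k) (\<lambda>\<omega>. small k \<omega> t $ i) \<omega>)"
    interpret F: sigma_finite_subalgebra M "history M p Z k" by (rule cond_exp_F)
    let ?E = "real_cond_exp M (history M p Z k) (\<lambda>\<omega>. small k \<omega> t $ i)"
    show "\<forall>h\<in>borel_measurable (history M p Z k). \<forall>b. (\<forall>\<omega>. \<bar>h \<omega>\<bar> \<le> b) \<longrightarrow> (\<integral>\<omega>. h \<omega> * d k \<omega> t $ i \<partial>M) = 0"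
    proof (intro ballI allI impI)
      fix h :: "'w \<Rightarrow> real" and b assume h: "h \<in> borel_measurable (history M p Z k)" and b: "\<forall>\<omega>. \<bar>h \<omega>\<bar> \<le> b"
      \<comment> \<open>All factors known at time k; the defining property of the conditional
        expectation applies with g as the test function.\<close>
      define g where "g \<omega> = h \<omega> * (\<alpha> k * c k \<omega>)" for \<omega>
      have g: "g \<in> borel_measurable (history M p Z k)" using h c unfolding g_def by measurable
      have g_M [measurable]: "g \<in> borel_measurable M" using subalgebra_F g by (rule measurable_from_subalg)
      have [measurable]: "(\<lambda>\<omega>. small k \<omega> t $ i) \<in> borel_measurable M" "(\<lambda>\<omega>. zbar (Suc k) \<omega> t $ i) \<in> borel_measurable M"
        using * by (auto intro!: borel_measurable_vec_nth section_measurable(2)[OF small_measurable]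
            section_measurable(2)[OF zbar_measurable])
      have "\<bar>g \<omega>\<bar> \<le> b * (\<alpha> k * 1)" for \<omega>
        unfolding g_def abs_mult using b c_le[of k \<omega>] \<alpha>_pos[of k] order_trans[OF abs_ge_zero b[rule_format]]
        by (intro mult_mono) auto
      then have "\<bar>g \<omega> * small k \<omega> t $ i\<bar> \<le> b * (\<alpha> k * 1) * (1 / \<alpha> k)" for \<omega>
        unfolding abs_mult by (intro mult_mono abs_small_le) (auto intro: order_trans[OF abs_ge_zero])
      then have int: "integrable M (\<lambda>\<omega>. g \<omega> * small k \<omega> t $ i)"
        by (intro integrable_const_bound[of _ "b * (\<alpha> k * 1) * (1 / \<alpha> k)"]) auto
      note E = F.real_cond_exp_intg[OF int g]
      have "(\<integral>\<omega>. h \<omega> * d k \<omega> t $ i \<partial>M) = (\<integral>\<omega>. g \<omega> * small k \<omega> t $ i - g \<omega> * ?E \<omega> \<partial>M)"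
      proof (rule integral_cong_AE)
        have "AE \<omega> in M. zbar (Suc k) \<omega> t $ i = ?E \<omega>" using * by blast
        then show "AE \<omega> in M. h \<omega> * d k \<omega> t $ i = g \<omega> * small k \<omega> t $ i - g \<omega> * ?E \<omega>"
          by eventually_elim (simp add: d_def g_def algebra_simps)
        have [measurable]: "h \<in> borel_measurable M" using subalgebra_F h by (rule measurable_from_subalg)
        show "(\<lambda>\<omega>. h \<omega> * d k \<omega> t $ i) \<in> borel_measurable M"
          unfolding d_def by simp
      qed simp
      also have "\<dots> = 0" using int E by simp
      finally show "(\<integral>\<omega>. h \<omega> * d k \<omega> t $ i \<partial>M) = 0" .
    qed
  qed
  show "(\<integral>\<^sup>+\<omega>. \<integral>\<^sup>+t. ennreal ((norm (d k \<omega> t))\<^sup>2) \<partial>unit_leb \<partial>M) \<le> ennreal ((\<alpha> k)\<^sup>2 * \<sigma>2 k)" for k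
  proof -
    define f where "f x = ennreal ((norm (small k (fst x) (snd x) - zbar (Suc k) (fst x) (snd x)))\<^sup>2)" for x
    have f [measurable]: "f \<in> borel_measurable (M \<Otimes>\<^sub>M unit_leb)" unfolding f_def by measurable
    have fsec: "(\<lambda>t. f (\<omega>, t)) \<in> borel_measurable unit_leb" if "\<omega> \<in> space M" for \<omega>
      by (rule measurable_Pair2[OF f that])
    have "ennreal ((norm (d k \<omega> t))\<^sup>2) \<le> ennreal ((\<alpha> k)\<^sup>2) * f (\<omega>, t)" for \<omega> t
    proof -
      have "(\<alpha> k * \<bar>c k \<omega>\<bar>)\<^sup>2 \<le> (\<alpha> k * 1)\<^sup>2"
        using \<alpha>_pos[of k] by (intro power_mono mult_left_mono c_le) auto
      then have "(norm (d k \<omega> t))\<^sup>2 \<le> (\<alpha> k)\<^sup>2 * (norm (small k \<omega> t - zbar (Suc k) \<omega> t))\<^sup>2"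
        by (simp add: d_def power_mult_distrib mult_right_mono)
      then show ?thesis unfolding f_def by (simp add: ennreal_mult[symmetric] ennreal_leI)
    qed
    then have "(\<integral>\<^sup>+\<omega>. \<integral>\<^sup>+t. ennreal ((norm (d k \<omega> t))\<^sup>2) \<partial>unit_leb \<partial>M)
        \<le> (\<integral>\<^sup>+\<omega>. \<integral>\<^sup>+t. ennreal ((\<alpha> k)\<^sup>2) * f (\<omega>, t) \<partial>unit_leb \<partial>M)"
      by (intro nn_integral_mono)
    also have "\<dots> = (\<integral>\<^sup>+\<omega>. ennreal ((\<alpha> k)\<^sup>2) * (\<integral>\<^sup>+t. f (\<omega>, t) \<partial>unit_leb) \<partial>M)"
      by (intro nn_integral_cong nn_integral_cmult fsec)
    also have "\<dots> = ennreal ((\<alpha> k)\<^sup>2) * (\<integral>\<^sup>+\<omega>. \<integral>\<^sup>+t. f (\<omega>, t) \<partial>unit_leb \<partial>M)"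
      by (intro nn_integral_cmult unit.borel_measurable_nn_integral_fst f)
    also have "\<dots> \<le> ennreal ((\<alpha> k)\<^sup>2) * ennreal (\<sigma>2 k)"
      using square_bound[of k] by (intro mult_left_mono) (auto simp: f_def)
    also have "\<dots> = ennreal ((\<alpha> k)\<^sup>2 * \<sigma>2 k)" using \<sigma>2_nonneg by (simp add: ennreal_mult)
    finally show ?thesis .
  qed
  show "sets (history M p Z m) \<subseteq> sets (history M p Z n)" if "m \<le> n" for m n
    using that by (rule history_mono)
qed (use subalgebra_F \<sigma>2_nonneg \<sigma>2_sum in auto)

end

section \<open>Cauchy property of the weighted noise sums in L^p\<close>

lemma Lnorm_2_le:
  fixes f :: "'a \<Rightarrow> 'b::{real_normed_vector, second_countable_topology}"
  assumes [measurable]: "f \<in> borel_measurable M" and "0 \<le> \<eta>"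
    and le: "(\<integral>\<^sup>+x. ennreal ((norm (f x))\<^sup>2) \<partial>M) < ennreal (\<eta>\<^sup>2)"
  shows "integrable M (\<lambda>x. norm (f x) powr 2)" and "Lnorm M 2 f \<le> \<eta>"
proof -
  have fin: "(\<integral>\<^sup>+x. ennreal ((norm (f x))\<^sup>2) \<partial>M) < \<infinity>"
    using le by (rule order.strict_trans) simp
  then have int: "integrable M (\<lambda>x. (norm (f x))\<^sup>2)"
    by (intro integrableI_nonneg) auto
  then show "integrable M (\<lambda>x. norm (f x) powr 2)" by simp
  have "ennreal (\<integral>x. (norm (f x))\<^sup>2 \<partial>M) < ennreal (\<eta>\<^sup>2)"
    using le nn_integral_eq_integral[OF int] by simp
  then have "(\<integral>x. (norm (f x))\<^sup>2 \<partial>M) \<le> \<eta>\<^sup>2"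
    by (simp add: ennreal_less_iff)
  then have "sqrt (\<integral>x. (norm (f x))\<^sup>2 \<partial>M) \<le> \<eta>"
    using \<open>0 \<le> \<eta>\<close> by (intro real_le_lsqrt) auto
  then show "Lnorm M 2 f \<le> \<eta>" by (simp add: Lnorm_def powr_half_sqrt)
qed

context truncated_noise
begin

text \<open>With c = \<lambda> / \<nu> these are the increments of S. The adaptedness of c serves
  the martingale part; in the other two parts |c| \<le> 1 reduces the claim to summable
  norms.\<close>

lemma noise_sum_Cauchy:
  assumes c: "\<And>n. c n \<in> borel_measurable (history M p Z n)" and c_le: "\<And>n \<omega>. \<bar>c n \<omega>\<bar> \<le> 1"
    and \<delta>: "\<And>n. expectation_le M
      (\<lambda>\<omega>. (\<integral>t. norm (z (Suc n) \<omega> t) powr p *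
        indicat_real {s. 1 \<le> norm (\<alpha> n *\<^sub>R z (Suc n) \<omega> s)} t \<partial>unit_leb) powr (1 / p)) (\<delta> n)"
    and \<mu>: "\<And>n. expectation_le M
      (\<lambda>\<omega>. (\<integral>t. norm (zbar (Suc n) \<omega> t) powr p \<partial>unit_leb) powr (1 / p)) (\<mu> n)"
    and sums: "summable (\<lambda>n. \<alpha> n * \<delta> n)" "summable (\<lambda>n. \<alpha> n * \<mu> n)"
  shows "AE \<omega> in M. \<forall>\<eta>>0. \<exists>m. \<forall>i j. m \<le> i \<longrightarrow> i \<le> j \<longrightarrow>
    Lp_norm p (\<Sum>k = i..<j. (\<alpha> k * c k \<omega>) *\<^sub>R Z (Suc k) \<omega>) \<le> \<eta>"
proof -
  \<comment> \<open>Equal to z where the truncation cuts and to 0 elsewhere, so its p-th power is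
    the integrand in the hypothesis on \<delta>.\<close>
  define big where "big n \<omega> t = z (Suc n) \<omega> t - small n \<omega> t" for n \<omega> t
  have "expectation_le M (\<lambda>\<omega>. Lnorm unit_leb p (big n \<omega>)) (\<delta> n)" for n
  proof -
    have "norm (z (Suc n) \<omega> t) powr p * indicat_real {s. 1 \<le> norm (\<alpha> n *\<^sub>R z (Suc n) \<omega> s)} t
        = norm (big n \<omega> t) powr p" for \<omega> t
      using \<alpha>_pos[of n] p by (auto simp: big_def small_def)
    then show ?thesis using \<delta>[of n] by (simp add: Lnorm_def)
  qed
  then have "AE \<omega> in M. summable (\<lambda>n. \<alpha> n * Lnorm unit_leb p (big n \<omega>))"
    using \<alpha>_pos sums(1) by (intro AE_summable_of_expectation_le) (auto simp: Lnorm_nonneg less_imp_le)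
  moreover have "AE \<omega> in M. summable (\<lambda>n. \<alpha> n * Lnorm unit_leb p (zbar (Suc n) \<omega>))"
    using \<alpha>_pos sums(2) \<mu>
    by (intro AE_summable_of_expectation_le) (auto simp: Lnorm_nonneg less_imp_le Lnorm_def)
  moreover have "AE \<omega> in M. \<forall>n. integrable unit_leb (\<lambda>t. norm (zbar (Suc n) \<omega> t) powr p)"
    using AE_zbar_powr_integrable[of p] p by (simp add: AE_all_countable)
  moreover note martingale_part_tail[OF c c_le] AE_space
  ultimately show ?thesis
  proof eventually_elim
    fix \<omega>
    assume big_sum: "summable (\<lambda>n. \<alpha> n * Lnorm unit_leb p (big n \<omega>))"
      and zbar_sum: "summable (\<lambda>n. \<alpha> n * Lnorm unit_leb p (zbar (Suc n) \<omega>))"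
      and zbar_int: "\<forall>n. integrable unit_leb (\<lambda>t. norm (zbar (Suc n) \<omega> t) powr p)"
      and tail: "\<forall>\<epsilon>>0. \<exists>m. \<forall>n. (\<integral>\<^sup>+t. ennreal ((norm (\<Sum>k<n. (\<alpha> (m + k) * c (m + k) \<omega>) *\<^sub>R
          (small (m + k) \<omega> t - zbar (Suc (m + k)) \<omega> t)))\<^sup>2) \<partial>unit_leb) < \<epsilon>"
      and \<omega>: "\<omega> \<in> space M"
    interpret seminormed_subspace "Lp p :: 'd mfun set" "Lp_norm p" by (rule seminormed_subspace_Lp[OF p(1)])
    have [measurable]: "zbar (Suc n) \<omega> \<in> borel_measurable unit_leb" "small n \<omega> \<in> borel_measurable unit_leb"
      "z n \<omega> \<in> borel_measurable unit_leb" for n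
      by (rule section_measurable(1)[OF _ \<omega>], measurable)+
    have [measurable]: "big n \<omega> \<in> borel_measurable unit_leb" for n
      unfolding big_def by measurable
    have Z_eq: "Z n \<omega> = abs_mfun (z n \<omega>)" for n using z[of n] \<omega> by (simp add: representative_def)
    have Z_Lp: "Z n \<omega> \<in> Lp p" for n using measurable_space[OF Z_measurable \<omega>] by simp
    have z_int: "integrable unit_leb (\<lambda>t. norm (z n \<omega> t) powr p)" for n
      using Z_Lp[of n] by (simp add: Z_eq abs_mfun_in_Lp_iff)
    have "integrable unit_leb (\<lambda>t. norm (big n \<omega> t) powr p)" for n
      by (rule Bochner_Integration.integrable_bound[OF z_int[of "Suc n"]])
        (auto simp: big_def small_def intro!: AE_I2)
    then have big_Lp: "abs_mfun (big n \<omega>) \<in> Lp p" for n by (simp add: abs_mfun_in_Lp_iff)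
    have zbar_Lp: "abs_mfun (zbar (Suc n) \<omega>) \<in> Lp p" for n using zbar_int by (simp add: abs_mfun_in_Lp_iff)
    define d where "d n t = (\<alpha> n * c n \<omega>) *\<^sub>R (small n \<omega> t - zbar (Suc n) \<omega> t)" for n t
    have [measurable]: "d n \<in> borel_measurable unit_leb" for n unfolding d_def by measurable
    have split: "(\<alpha> n * c n \<omega>) *\<^sub>R Z (Suc n) \<omega> = (\<alpha> n * c n \<omega>) *\<^sub>R abs_mfun (big n \<omega>) +
        (\<alpha> n * c n \<omega>) *\<^sub>R abs_mfun (zbar (Suc n) \<omega>) + abs_mfun (d n)" for n
    proof -
      have "(\<lambda>t. (\<alpha> n * c n \<omega>) *\<^sub>R z (Suc n) \<omega> t)
          = (\<lambda>t. (\<alpha> n * c n \<omega>) *\<^sub>R big n \<omega> t + (\<alpha> n * c n \<omega>) *\<^sub>R zbar (Suc n) \<omega> t + d n t)"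
        by (simp add: big_def d_def fun_eq_iff scaleR_right_diff_distrib)
      then show ?thesis by (simp add: Z_eq scaleR_abs_mfun plus_abs_mfun)
    qed
    have d_Lp: "abs_mfun (d n) \<in> Lp p" for n
    proof -
      have "abs_mfun (d n) = (\<alpha> n * c n \<omega>) *\<^sub>R Z (Suc n) \<omega> - (\<alpha> n * c n \<omega>) *\<^sub>R abs_mfun (big n \<omega>)
          - (\<alpha> n * c n \<omega>) *\<^sub>R abs_mfun (zbar (Suc n) \<omega>)"
        by (simp add: split)
      then show ?thesis by (simp add: diff_closed scale_closed Z_Lp big_Lp zbar_Lp)
    qed
    have weighted: "Lp_norm p (\<Sum>k = i..<j. (\<alpha> k * c k \<omega>) *\<^sub>R abs_mfun (f k)) \<le> (\<Sum>k = i..<j. \<alpha> k * Lnorm unit_leb p (f k))"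
      if [measurable]: "\<And>k. f k \<in> borel_measurable unit_leb" and f: "\<And>k. abs_mfun (f k) \<in> Lp p"
      for f :: "nat \<Rightarrow> real \<Rightarrow> real ^ 'd" and i j
    proof -
      have "Lp_norm p ((\<alpha> k * c k \<omega>) *\<^sub>R abs_mfun (f k)) \<le> \<alpha> k * Lnorm unit_leb p (f k)" for k
      proof -
        have "\<alpha> k * \<bar>c k \<omega>\<bar> * Lnorm unit_leb p (f k) \<le> \<alpha> k * 1 * Lnorm unit_leb p (f k)"
          using \<alpha>_pos[of k] by (intro mult_right_mono mult_left_mono c_le Lnorm_nonneg) auto
        then show ?thesis using \<alpha>_pos[of k] by (simp add: homogeneous f abs_mult Lp_norm_abs_mfun)
      qed
      then show ?thesis
        by (intro order_trans[OF seminorm_sum sum_mono]) (auto intro: scale_closed f)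
    qed
    show "\<forall>\<eta>>0. \<exists>m. \<forall>i j. m \<le> i \<longrightarrow> i \<le> j \<longrightarrow>
      Lp_norm p (\<Sum>k = i..<j. (\<alpha> k * c k \<omega>) *\<^sub>R Z (Suc k) \<omega>) \<le> \<eta>"
    proof (intro allI impI)
      fix \<eta> :: real assume "0 < \<eta>"
      \<comment> \<open>One quarter each for the cut-off part and the conditional means, and two for
        the martingale part: \<open>tail\<close> controls only sums that start at m3, so a sum from
        i to j is a difference of two of them.\<close>
      define r where "r = \<eta> / 4"
      have r: "0 < r" using \<open>0 < \<eta>\<close> by (simp add: r_def)
      obtain m1 where m1: "\<forall>i\<ge>m1. \<forall>j. norm (\<Sum>k = i..<j. \<alpha> k * Lnorm unit_leb p (big k \<omega>)) < r"
        using big_sum r unfolding summable_Cauchy by blast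
      obtain m2 where m2: "\<forall>i\<ge>m2. \<forall>j. norm (\<Sum>k = i..<j. \<alpha> k * Lnorm unit_leb p (zbar (Suc k) \<omega>)) < r"
        using zbar_sum r unfolding summable_Cauchy by blast
      have "0 < ennreal (r\<^sup>2)" using r by simp
      with tail obtain m3 where m3: "\<forall>n. (\<integral>\<^sup>+t. ennreal ((norm (\<Sum>k<n. d (m3 + k) t))\<^sup>2) \<partial>unit_leb) < ennreal (r\<^sup>2)"
        unfolding d_def by blast
      have d_sum: "Lp_norm p (\<Sum>k = m3..<j. abs_mfun (d k)) \<le> r" if "m3 \<le> j" for j
      proof -
        have reindex: "(\<Sum>k<j - m3. d (m3 + k) t) = (\<Sum>k = m3..<j. d k t)" for t
          using that sum.shift_bounds_nat_ivl[of "\<lambda>k. d k t" 0 m3 "j - m3"]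
          by (simp add: atLeast0LessThan add.commute)
        have "(\<integral>\<^sup>+t. ennreal ((norm (\<Sum>k = m3..<j. d k t))\<^sup>2) \<partial>unit_leb) < ennreal (r\<^sup>2)"
          using m3[rule_format, of "j - m3"] by (simp add: reindex)
        then have L2: "integrable unit_leb (\<lambda>t. norm (\<Sum>k = m3..<j. d k t) powr 2)"
          "Lnorm unit_leb 2 (\<lambda>t. \<Sum>k = m3..<j. d k t) \<le> r"
          using r by (intro Lnorm_2_le; simp)+
        have "Lp_norm p (\<Sum>k = m3..<j. abs_mfun (d k)) = Lnorm unit_leb p (\<lambda>t. \<Sum>k = m3..<j. d k t)"
          by (subst sum_abs_mfun) (auto intro: Lp_norm_abs_mfun)
        also have "\<dots> \<le> Lnorm unit_leb 2 (\<lambda>t. \<Sum>k = m3..<j. d k t)"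
          using p L2(1) by (intro Lnorm_mono_exponent(2) prob_space_unit_leb) auto
        finally show ?thesis using L2(2) by simp
      qed
      have "Lp_norm p (\<Sum>k = i..<j. (\<alpha> k * c k \<omega>) *\<^sub>R Z (Suc k) \<omega>) \<le> \<eta>"
        if i: "max m1 (max m2 m3) \<le> i" "i \<le> j" for i j
      proof -
        have A: "Lp_norm p (\<Sum>k = i..<j. (\<alpha> k * c k \<omega>) *\<^sub>R abs_mfun (big k \<omega>)) \<le> r"
          using weighted[of "\<lambda>k. big k \<omega>" i j] m1[rule_format, of i j] i big_Lp by auto
        have B: "Lp_norm p (\<Sum>k = i..<j. (\<alpha> k * c k \<omega>) *\<^sub>R abs_mfun (zbar (Suc k) \<omega>)) \<le> r"
          using weighted[of "\<lambda>k. zbar (Suc k) \<omega>" i j] m2[rule_format, of i j] i zbar_Lp by auto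
        have "(\<Sum>k = i..<j. abs_mfun (d k)) = (\<Sum>k = m3..<j. abs_mfun (d k)) - (\<Sum>k = m3..<i. abs_mfun (d k))"
          using i by (simp add: sum_diff_nat_ivl)
        then have D: "Lp_norm p (\<Sum>k = i..<j. abs_mfun (d k)) \<le> r + r"
          using i d_sum[of i] d_sum[of j]
            triangle_diff[of "\<Sum>k = m3..<j. abs_mfun (d k)" "\<Sum>k = m3..<i. abs_mfun (d k)"]
          by (simp add: sum_closed d_Lp)
        have "Lp_norm p (\<Sum>k = i..<j. (\<alpha> k * c k \<omega>) *\<^sub>R Z (Suc k) \<omega>) \<le> r + r + (r + r)"
          unfolding split sum.distrib
          by (intro order_trans[OF triangle] add_mono A B D add_closed sum_closed scale_closed big_Lp zbar_Lp d_Lp)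
        then show ?thesis by (simp add: r_def)
      qed
      then show "\<exists>m. \<forall>i j. m \<le> i \<longrightarrow> i \<le> j \<longrightarrow>
        Lp_norm p (\<Sum>k = i..<j. (\<alpha> k * c k \<omega>) *\<^sub>R Z (Suc k) \<omega>) \<le> \<eta>" by blast
    qed
  qed
qed

end

section \<open>The stochastic recursion as a driven contraction\<close>

theorem theorem4:
  fixes p \<rho> \<theta> C :: real
    and G :: "('d::finite) mfun \<Rightarrow> 'd mfun"
    and x_star y0 :: "'d mfun"
    and lam :: "nat \<Rightarrow> 'd mfun list \<Rightarrow> real"
    and \<alpha> \<delta> \<mu> \<sigma>2 :: "nat \<Rightarrow> real"
    and M :: "'w measure"
    and Z Y :: "nat \<Rightarrow> 'w \<Rightarrow> 'd mfun"
    and z zbar :: "nat \<Rightarrow> 'w \<Rightarrow> real \<Rightarrow> real ^ 'd"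
  assumes p: "1 \<le> p" "p \<le> 2"
    and G_maps: "\<And>x. x \<in> Lp p \<Longrightarrow> G x \<in> Lp p"
    and x_star: "x_star \<in> Lp p" "G x_star = 0"
    and x_star_unique: "\<And>x. x \<in> Lp p \<Longrightarrow> G x = 0 \<Longrightarrow> x = x_star"
    and \<rho>: "0 < \<rho>" "\<rho> < 1"
    and \<theta>: "1 \<le> \<theta>"
    and contr: "\<And>x. x \<in> Lp p \<Longrightarrow>
      Lp_norm p (inverse \<theta> *\<^sub>R G x - (x - x_star)) \<le> \<rho> * Lp_norm p (x - x_star)"
    and lam_bound: "\<And>n us. length us = Suc n \<Longrightarrow> set us \<subseteq> Lp p \<Longrightarrow>
      \<bar>lam n us\<bar> \<le> C * (1 + Max (Lp_norm p ` set us))"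
    and \<alpha>: "\<And>n. 0 < \<alpha> n" "\<And>n. \<alpha> n < 1" "\<alpha> \<longlonglongrightarrow> 0"
    and \<alpha>_sum: "filterlim (\<lambda>N. \<Sum>n<N. \<alpha> n) at_top sequentially"
    and M: "prob_space M"
    and Z: "\<And>n. Z n \<in> M \<rightarrow>\<^sub>M Lp_borel p"
    and z: "\<And>n. representative M (z n) (Z n)"
    and zbar: "\<And>n. cond_exp_version M (history M p Z n)
      (\<lambda>\<omega> t. indicat_real {s. \<alpha> n * norm (z (Suc n) \<omega> s) < 1} t *\<^sub>R z (Suc n) \<omega> t)
      (zbar (Suc n))"
    and \<delta>: "\<And>n. expectation_le M
      (\<lambda>\<omega>. (\<integral>t. norm (z (Suc n) \<omega> t) powr p *
        indicat_real {s. 1 \<le> norm (\<alpha> n *\<^sub>R z (Suc n) \<omega> s)} t \<partial>unit_leb) powr (1 / p)) (\<delta> n)"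
    and \<mu>: "\<And>n. expectation_le M
      (\<lambda>\<omega>. (\<integral>t. norm (zbar (Suc n) \<omega> t) powr p \<partial>unit_leb) powr (1 / p)) (\<mu> n)"
    and \<sigma>2: "\<And>n. expectation_le M
      (\<lambda>\<omega>. \<integral>t. (norm (indicat_real {s. norm (\<alpha> n *\<^sub>R z (Suc n) \<omega> s) < 1} t *\<^sub>R z (Suc n) \<omega> t
        - zbar (Suc n) \<omega> t))\<^sup>2 \<partial>unit_leb) (\<sigma>2 n)"
    and sums: "summable (\<lambda>n. \<alpha> n * \<delta> n)" "summable (\<lambda>n. \<alpha> n * \<mu> n)"
      "summable (\<lambda>n. (\<alpha> n)\<^sup>2 * \<sigma>2 n)"
    and y0: "y0 \<in> Lp p"
    and Y_0: "\<And>\<omega>. \<omega> \<in> space M \<Longrightarrow> Y 0 \<omega> = y0"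
    and Y_Suc: "\<And>n \<omega>. \<omega> \<in> space M \<Longrightarrow> Y (Suc n) \<omega> =
      Y n \<omega> - \<alpha> n *\<^sub>R (G (Y n \<omega>) + lam n (map (\<lambda>k. Y k \<omega>) [0..<Suc n]) *\<^sub>R Z (Suc n) \<omega>)"
    and lam_adapted: "\<And>n. (\<lambda>\<omega>. lam n (map (\<lambda>k. Y k \<omega>) [0..<Suc n]))
      \<in> borel_measurable (history M p Z n)"
  shows "AE \<omega> in M. (\<lambda>n. Lp_norm p (Y (Suc n) \<omega> - x_star)) \<longlonglongrightarrow> 0"
proof -
  interpret prob_space M by (rule M)
  interpret noise: truncated_noise M p \<alpha> \<sigma>2 Z z zbar
    by unfold_locales (use p \<alpha> Z z zbar \<sigma>2 sums in auto)
  interpret seminormed_subspace "Lp p :: 'd mfun set" "Lp_norm p" by (rule seminormed_subspace_Lp[OF p(1)])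
  define L where "L n \<omega> = lam n (map (\<lambda>k. Y k \<omega>) [0..<Suc n])" for n \<omega>
  \<comment> \<open>The 1 permits division by \<open>\<nu>\<close> even if all multipliers
    vanish.\<close>
  define \<nu> where "\<nu> n \<omega> = max 1 (Max ((\<lambda>k. \<bar>L k \<omega>\<bar>) ` {..n}))" for n \<omega>
  define c where "c n \<omega> = L n \<omega> / \<nu> n \<omega>" for n \<omega>
  have \<nu>_ge: "1 \<le> \<nu> n \<omega>" "k \<le> n \<Longrightarrow> \<bar>L k \<omega>\<bar> \<le> \<nu> n \<omega>" for n k \<omega>
    by (auto simp: \<nu>_def intro!: max.coboundedI2 Max_ge)
  have \<nu>_mono: "mono (\<lambda>n. \<nu> n \<omega>)" for \<omega>
    unfolding \<nu>_def by (intro monoI max.mono Max_mono order_refl image_mono) auto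
  have c_le: "\<bar>c n \<omega>\<bar> \<le> 1" for n \<omega>
    using \<nu>_ge(1)[of n \<omega>] \<nu>_ge(2)[of n n \<omega>] by (simp add: c_def)
  have L_F: "L k \<in> borel_measurable (history M p Z n)" if "k \<le> n" for k n
    using lam_adapted[of k] history_mono[OF that, where M = M and p = p and Z = Z]
    unfolding L_def by (auto simp: measurable_def)
  \<comment> \<open>Here \<open>lam_adapted\<close> enters: the multipliers up to time n, and with
    them their maximum, are known at time n.\<close>
  have c_F: "c n \<in> borel_measurable (history M p Z n)" for n
  proof -
    have [measurable]: "(\<lambda>\<omega>. Max ((\<lambda>k. \<bar>L k \<omega>\<bar>) ` {..n})) \<in> borel_measurable (history M p Z n)"
      using L_F by (intro borel_measurable_Max borel_measurable_abs) auto
    have [measurable]: "L n \<in> borel_measurable (history M p Z n)" by (rule L_F) simp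
    show ?thesis unfolding c_def \<nu>_def by measurable
  qed
  have "AE \<omega> in M. \<forall>\<eta>>0. \<exists>m. \<forall>i j. m \<le> i \<longrightarrow> i \<le> j \<longrightarrow>
      Lp_norm p (\<Sum>k = i..<j. (\<alpha> k * c k \<omega>) *\<^sub>R Z (Suc k) \<omega>) \<le> \<eta>"
    by (rule noise.noise_sum_Cauchy[OF c_F c_le \<delta> \<mu> sums(1,2)])
  with AE_space show ?thesis
  proof eventually_elim
    fix \<omega> assume \<omega>: "\<omega> \<in> space M"
      and cauchy: "\<forall>\<eta>>0. \<exists>m. \<forall>i j. m \<le> i \<longrightarrow> i \<le> j \<longrightarrow>
        Lp_norm p (\<Sum>k = i..<j. (\<alpha> k * c k \<omega>) *\<^sub>R Z (Suc k) \<omega>) \<le> \<eta>"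
    have Z_Lp: "Z n \<omega> \<in> Lp p" for n using measurable_space[OF Z \<omega>] by simp
    have Y_Lp: "Y n \<omega> \<in> Lp p" for n
      by (induction n) (auto simp: Y_0[OF \<omega>] Y_Suc[OF \<omega>] simp del: upt_Suc intro!: y0 diff_closed add_closed scale_closed G_maps Z_Lp)
    define e where "e n = Y n \<omega> - x_star" for n
    define R where "R n = inverse \<theta> *\<^sub>R G (Y n \<omega>) - e n" for n
    define S where "S n = (\<Sum>k = 0..<n. (\<alpha> k * c k \<omega>) *\<^sub>R Z (Suc k) \<omega>)" for n
    \<comment> \<open>Writing G(Y_n) = \<theta> (R n + e n) moves \<theta> into the step size and
      leaves \<open>contr\<close> as the bound on R.\<close>
    interpret driven_contraction "Lp p" "Lp_norm p" "\<lambda>n. \<theta> * \<alpha> n" "\<lambda>n. \<nu> n \<omega>" e R S \<rho>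
    proof
      show e: "e n \<in> Lp p" for n unfolding e_def by (intro diff_closed Y_Lp x_star)
      show "R n \<in> Lp p" for n unfolding R_def by (intro diff_closed scale_closed G_maps Y_Lp e)
      show "S n \<in> Lp p" for n unfolding S_def by (intro sum_closed scale_closed Z_Lp)
      show "Lp_norm p (R n) \<le> \<rho> * Lp_norm p (e n)" for n
        unfolding R_def e_def by (rule contr[OF Y_Lp])
      show "e (Suc n) = (1 - \<theta> * \<alpha> n) *\<^sub>R e n - (\<theta> * \<alpha> n) *\<^sub>R R n - \<nu> n \<omega> *\<^sub>R (S (Suc n) - S n)" for n
      proof -
        have "e (Suc n) = e n - \<alpha> n *\<^sub>R (G (Y n \<omega>) + L n \<omega> *\<^sub>R Z (Suc n) \<omega>)"
          by (simp add: e_def Y_Suc[OF \<omega>] L_def del: upt_Suc)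
        moreover have "G (Y n \<omega>) = \<theta> *\<^sub>R (R n + e n)" using \<theta> by (simp add: R_def)
        moreover have "\<nu> n \<omega> *\<^sub>R (S (Suc n) - S n) = (\<alpha> n * L n \<omega>) *\<^sub>R Z (Suc n) \<omega>"
          using \<nu>_ge(1)[of n \<omega>] by (simp add: S_def c_def)
        ultimately show ?thesis by (simp add: algebra_simps)
      qed
      show "0 \<le> \<nu> n \<omega>" for n using \<nu>_ge(1)[of n \<omega>] by simp
    qed (use \<rho> \<theta> \<alpha> \<nu>_mono in auto)
    have "(\<lambda>n. Lp_norm p (e n)) \<longlonglongrightarrow> 0"
    proof (rule error_tendsto_zero)
      show "(\<lambda>n. \<theta> * \<alpha> n) \<longlonglongrightarrow> 0" using tendsto_mult_left[OF \<alpha>(3), of \<theta>] by simp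
      show "filterlim (\<lambda>n. \<Sum>i<n. \<theta> * \<alpha> i) at_top sequentially"
        unfolding sum_distrib_left[symmetric] using \<theta>
        by (intro filterlim_tendsto_pos_mult_at_top[OF tendsto_const _ \<alpha>_sum]) auto
      show "\<exists>m. \<forall>i j. m \<le> i \<longrightarrow> i \<le> j \<longrightarrow> Lp_norm p (S j - S i) \<le> \<eta>" if "0 < \<eta>" for \<eta>
      proof -
        have "S j - S i = (\<Sum>k = i..<j. (\<alpha> k * c k \<omega>) *\<^sub>R Z (Suc k) \<omega>)" if "i \<le> j" for i j
          using that by (simp add: S_def sum_diff_nat_ivl)
        with cauchy \<open>0 < \<eta>\<close> show ?thesis by simp
      qed
      \<comment> \<open>The norm of Y_k is at most that of \<open>x_star\<close> plus that of e k,
        and 1 + u + v \<le> (1 + u) (1 + v) separates the two. The factor 1 + |C| covers both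
        entries of the maximum in \<open>\<nu>\<close>.\<close>
      show "\<nu> n \<omega> \<le> (1 + \<bar>C\<bar>) * (1 + Lp_norm p x_star) * (1 + Max ((\<lambda>k. Lp_norm p (e k)) ` {..n}))" for n
      proof -
        define E where "E = Max ((\<lambda>k. Lp_norm p (e k)) ` {..n})"
        have e_le: "Lp_norm p (e k) \<le> E" if "k \<le> n" for k
          unfolding E_def using that by (intro Max_ge) auto
        have nonneg: "0 \<le> Lp_norm p x_star" "0 \<le> E"
          using seminorm_nonneg[OF x_star(1)] seminorm_nonneg[OF e_in, of 0] e_le[of 0] by auto
        have Y_le: "Lp_norm p (Y k \<omega>) \<le> Lp_norm p x_star + E" if "k \<le> n" for k
          using triangle[OF e_in x_star(1), of k] e_le[OF that] by (simp add: e_def)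
        have "\<bar>L k \<omega>\<bar> \<le> \<bar>C\<bar> * (1 + (Lp_norm p x_star + E))" if "k \<le> n" for k
        proof -
          let ?us = "map (\<lambda>k. Y k \<omega>) [0..<Suc k]"
          have us: "set ?us = (\<lambda>k. Y k \<omega>) ` {..k}" by (auto simp del: upt_Suc)
          have max: "0 \<le> Max (Lp_norm p ` set ?us)" "Max (Lp_norm p ` set ?us) \<le> Lp_norm p x_star + E"
            unfolding us using that seminorm_nonneg[OF Y_Lp, of 0]
            by (auto intro!: Y_le simp: Max_ge_iff)
          have "\<bar>L k \<omega>\<bar> \<le> C * (1 + Max (Lp_norm p ` set ?us))"
            unfolding L_def using Y_Lp by (intro lam_bound) (auto simp del: upt_Suc)
          also have "\<dots> \<le> \<bar>C\<bar> * (1 + (Lp_norm p x_star + E))"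
            using max by (intro mult_mono) auto
          finally show ?thesis .
        qed
        then have "\<nu> n \<omega> \<le> max 1 (\<bar>C\<bar> * (1 + (Lp_norm p x_star + E)))"
          unfolding \<nu>_def by (intro max.mono order_refl) (auto simp: Max_le_iff)
        also have "\<dots> \<le> (1 + \<bar>C\<bar>) * (1 + (Lp_norm p x_star + E))"
          using nonneg by (auto simp: algebra_simps)
        also have "\<dots> \<le> (1 + \<bar>C\<bar>) * ((1 + Lp_norm p x_star) * (1 + E))"
          using nonneg by (intro mult_left_mono) (auto simp: algebra_simps)
        finally show ?thesis by (simp add: E_def mult.assoc)
      qed
      show "0 < (1 + \<bar>C\<bar>) * (1 + Lp_norm p x_star)"
        using seminorm_nonneg[OF x_star(1)] by (intro mult_pos_pos) auto
    qed
    then show "(\<lambda>n. Lp_norm p (Y (Suc n) \<omega> - x_star)) \<longlonglongrightarrow> 0"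
      unfolding e_def by (rule LIMSEQ_Suc)
  qed
qed

end
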